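(* Fix $z_0\in\mathbb{H}$. Let $\tau_0:\mathcal{A}\times\mathcal{A}\to\mathbb{C}$ be the bilinear functional which on monomials $f^0U_{\gamma_0}, f^1U_{\gamma_1}\in\mathcal{A}$ (with $f^0,f^1$ homogeneous) is given by $$\tau_0(f^0U_{\gamma_0},f^1U_{\gamma_1})=\int_{z_0}^{\gamma_0z_0} f^0\cdot (f^1|\gamma_1)\,dz\quad\text{if } w(f^0)+w(f^1)=2 \text{ and }\gamma_0\gamma_1=1,$$ and $\tau_0(f^0U_{\gamma_0},f^1U_{\gamma_1})=0$ otherwise. Then $\tau_0$ is a cyclic cocycle on $\mathcal{A}$ and, with respect to the standard action of $\mathcal{H}_1$ on $\mathcal{A}$, $$\tau_0(h_{(1)}(a^0),h_{(2)}(a^1))=\delta(h)\,\tau_0(a^0,a^1),\qquad \forall\, h\in\mathcal{H}_1,\ a^0,a^1\in\mathcal{A}.$$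
   Context: **The Hopf algebra $\mathcal{H}_1$.** As an algebra, $\mathcal{H}_1$ is the universal enveloping algebra (over $\mathbb{C}$) of the Lie algebra with basis $\{X,Y,\delta_n;\ n\ge 1\}$ and brackets $[Y,X]=X$, $[Y,\delta_n]=n\delta_n$, $[X,\delta_n]=\delta_{n+1}$, $[\delta_k,\delta_\ell]=0$. The coproduct is the algebra homomorphism determined by $\Delta Y = Y\otimes 1+1\otimes Y$, $\Delta\delta_1=\delta_1\otimes 1+1\otimes\delta_1$, $\Delta X = X\otimes 1+1\otimes X+\delta_1\otimes Y$; Sweedler notation $\Delta h=h_{(1)}\otimes h_{(2)}$. The modular character $\delta:\mathcal{H}_1\to\mathbb{C}$ is the algebra character with $\delta(Y)=1$, $\delta(X)=0$, $\delta(\delta_n)=0$. **The algebra $\mathcal{A}$.** $\mathbb{H}$ is the upper half plane. $\mathcal{M}=\bigoplus_k\mathcal{M}_k$ is the graded algebra of holomorphic modular forms of all levels, $\mathcal{M}_k=\bigcup_N\mathcal{M}_k(\Gamma(N))$; $w(f)$ denotes the weight of $f$. $\mathrm{GL}^+(2,\mathbb{Q})$ acts by $(f|\gamma)(z)=\det(\gamma)^{k/2}(cz+d)^{-k}f(\gamma z)$ for $f$ of weight $k$, $\gamma=\begin{pmatrix}a&b\\c&d\end{pmatrix}$. $\mathcal{A}=\mathcal{M}\ltimes\mathrm{GL}^+(2,\mathbb{Q})$ is the algebra of finite sums $\sum f_\gamma U_\gamma$ with product $(fU_\alpha)(gU_\beta)=f\cdot(g|\alpha^{-1})\,U_{\alpha\beta}$;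 $U_\gamma^*=U_{\gamma^{-1}}$. **Standard action.** It is the (unique) Hopf action of $\mathcal{H}_1$ on $\mathcal{A}$ such that on monomials $Y(fU_\gamma^* )=\frac{w(f)}{2}fU_\gamma^*$; $X(fU_\gamma^* )=X(f)U_\gamma^*$ with $X(f)=\frac1{2\pi i}\frac{df}{dz}-\frac1{2\pi i}\frac{d}{dz}(\log\eta^4)\,\frac{w(f)}{2}f$, $\eta$ being the Dedekind eta function; $\delta_1(fU_\gamma^* )=\mu_\gamma fU_\gamma^*$, where $\mu_\gamma(z)=\frac{1}{2\pi i}\frac{d}{dz}\log\frac{\eta^4|\gamma}{\eta^4}$ ($\eta^4$ having weight $2$). **Cyclic cocycle.** A bilinear $\tau$ on $\mathcal{A}$ is a cyclic ($1$-)cocycle if $\tau(a^0a^1,a^2)-\tau(a^0,a^1a^2)+\tau(a^2a^0,a^1)=0$ and $\tau(a^0,a^1)=-\tau(a^1,a^0)$. *)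

theory Defs
  imports
    "HOL-Complex_Analysis.Complex_Analysis"
    "HOL-Library.Poly_Mapping"
    "HOL-Library.Product_Plus"
    "HOL-Library.Function_Algebras"
begin

section \<open>Complex algebras\<close>

class complex_algebra = ring + monoid_mult +
  fixes cscale :: "complex \<Rightarrow> 'a \<Rightarrow> 'a"  (infixr "*c" 75)
  assumes cscale_add_right: "c *c (x + y) = c *c x + c *c y"
    and cscale_add_left: "(c + d) *c x = c *c x + d *c x"
    and cscale_cscale: "c *c d *c x = (c * d) *c x"
    and cscale_one: "1 *c x = x"
    and cscale_mult_left: "(c *c x) * y = c *c (x * y)"
    and cscale_mult_right: "x * (c *c y) = c *c (x * y)"

instantiation complex :: complex_algebra
begin
definition cscale_complex :: "complex \<Rightarrow> complex \<Rightarrow> complex" where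
  "cscale_complex c x = c * x"
instance by standard (simp_all add: cscale_complex_def algebra_simps)
end

definition alg_hom :: "('a::complex_algebra \<Rightarrow> 'b::complex_algebra) \<Rightarrow> bool" where
  "alg_hom F \<longleftrightarrow>
     (\<forall>x y. F (x + y) = F x + F y) \<and> (\<forall>c x. F (c *c x) = c *c F x) \<and>
     (\<forall>x y. F (x * y) = F x * F y) \<and> F 1 = 1"

inductive_set two_sided_ideal :: "'a::ring_1 set \<Rightarrow> 'a set" for R where
  zero: "0 \<in> two_sided_ideal R"
| gen: "r \<in> R \<Longrightarrow> a * r * b \<in> two_sided_ideal R"
| add: "x \<in> two_sided_ideal R \<Longrightarrow> y \<in> two_sided_ideal R \<Longrightarrow> x + y \<in> two_sided_ideal R"

lemma ideal_mult_left:
  assumes "x \<in> two_sided_ideal R" shows "c * x \<in> two_sided_ideal R"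
  using assms
proof induction
  case (gen r a b)
  then show ?case using two_sided_ideal.gen[of r R "c * a" b] by (simp add: mult.assoc)
qed (auto simp: distrib_left intro: two_sided_ideal.intros)

lemma ideal_mult_right:
  assumes "x \<in> two_sided_ideal R" shows "x * c \<in> two_sided_ideal R"
  using assms
proof induction
  case (gen r a b)
  then show ?case using two_sided_ideal.gen[of r R a "b * c"] by (simp add: mult.assoc)
qed (auto simp: distrib_right intro: two_sided_ideal.intros)

lemma ideal_uminus: "x \<in> two_sided_ideal R \<Longrightarrow> - x \<in> two_sided_ideal R"
  using ideal_mult_left[of x R "-1"] by simp

lemma ideal_eqI: "x = y \<Longrightarrow> x - y \<in> two_sided_ideal R"
  by (simp add: two_sided_ideal.zero)

lemma ideal_rel: "r \<in> R \<Longrightarrow> r \<in> two_sided_ideal R"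
  using two_sided_ideal.gen[of r R 1 1] by simp

lemma equivp_ideal: "equivp (\<lambda>p q. p - q \<in> two_sided_ideal R)"
proof (intro equivpI reflpI sympI transpI)
  fix p q r
  show "p - p \<in> two_sided_ideal R" by (simp add: two_sided_ideal.zero)
  show "q - p \<in> two_sided_ideal R" if "p - q \<in> two_sided_ideal R"
    using ideal_uminus[OF that] by simp
  show "p - r \<in> two_sided_ideal R"
    if "p - q \<in> two_sided_ideal R" "q - r \<in> two_sided_ideal R"
    using two_sided_ideal.add[OF that] by simp
qed

lemma ideal_cong_add:
  "p - q \<in> two_sided_ideal R \<Longrightarrow> p' - q' \<in> two_sided_ideal R
    \<Longrightarrow> (p + p') - (q + q') \<in> two_sided_ideal R"
  using two_sided_ideal.add[of "p - q" R "p' - q'"] by (simp add: algebra_simps)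

lemma ideal_cong_uminus:
  "p - q \<in> two_sided_ideal R \<Longrightarrow> (- p) - (- q) \<in> two_sided_ideal R"
  using ideal_uminus[of "p - q" R] by simp

lemma ideal_cong_minus:
  "p - q \<in> two_sided_ideal R \<Longrightarrow> p' - q' \<in> two_sided_ideal R
    \<Longrightarrow> (p - p') - (q - q') \<in> two_sided_ideal R"
  using two_sided_ideal.add[of "p - q" R "- (p' - q')"] ideal_uminus[of "p' - q'" R]
  by (simp add: algebra_simps)

lemma ideal_cong_mult:
  assumes "p - q \<in> two_sided_ideal R" "p' - q' \<in> two_sided_ideal R"
  shows "(p * p') - (q * q') \<in> two_sided_ideal R"
proof -
  have "p * p' - q * q' = (p - q) * p' + q * (p' - q')" by (simp add: algebra_simps)
  then show ?thesis
    using assms by (auto intro: two_sided_ideal.add ideal_mult_left ideal_mult_right)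
qed

text \<open>
  A finitely supported function on a monoid \<open>'m\<close> (written additively, though possibly not
  commutative) with the convolution product of \<open>Poly_Mapping\<close> is an element of the monoid
  algebra; \<open>single 0 c\<close> is the scalar \<open>c\<close>.
\<close>

lemma poly_mapping_sum_singles:
  fixes p :: "'k \<Rightarrow>\<^sub>0 'b::comm_monoid_add"
  shows "p = (\<Sum>k\<in>Poly_Mapping.keys p. Poly_Mapping.single k (Poly_Mapping.lookup p k))"
  by (rule poly_mapping_eqI)
     (auto simp: lookup_sum lookup_single when_def in_keys_iff sum.delta)

lemma poly_mapping_single_induct [case_names zero single add]:
  fixes p :: "'k \<Rightarrow>\<^sub>0 'b::comm_monoid_add"
  assumes "P 0" "\<And>k c. P (Poly_Mapping.single k c)" "\<And>p q. P p \<Longrightarrow> P q \<Longrightarrow> P (p + q)"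
  shows "P p"
proof -
  have "finite K \<Longrightarrow> P (\<Sum>k\<in>K. Poly_Mapping.single k (Poly_Mapping.lookup p k))" for K
    by (induction K rule: finite_induct) (auto simp: assms)
  then show ?thesis using poly_mapping_sum_singles[of p] finite_keys[of p] by metis
qed

lemma scalar_central:
  fixes p :: "'m::monoid_add \<Rightarrow>\<^sub>0 complex"
  shows "p * Poly_Mapping.single 0 c = Poly_Mapping.single 0 c * p"
  by (induction p rule: poly_mapping_single_induct)
     (simp_all add: mult_single algebra_simps)

lemma scalar_axioms:
  fixes p :: "'m::monoid_add \<Rightarrow>\<^sub>0 complex"
  shows "Poly_Mapping.single 0 (c + d) * p = Poly_Mapping.single 0 c * p + Poly_Mapping.single 0 d * p"
    and "Poly_Mapping.single 0 c * (Poly_Mapping.single 0 d * p) = Poly_Mapping.single 0 (c * d) * p"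
    and "Poly_Mapping.single 0 1 * p = p"
    and "p * (Poly_Mapping.single 0 c * q) = Poly_Mapping.single 0 c * (p * q)"
proof -
  show "p * (Poly_Mapping.single 0 c * q) = Poly_Mapping.single 0 c * (p * q)"
    by (metis mult.assoc scalar_central)
qed (simp_all add: single_add distrib_right mult_single flip: mult.assoc)

lemmas ring_laws = mult.assoc add.assoc add.commute distrib_left distrib_right mult_1_left
  mult_1_right add_0_left ab_left_minus diff_conv_add_uminus

section \<open>The Hopf algebra\<close>

text \<open>Words with concatenation; \<open>'g word \<Rightarrow>\<^sub>0 complex\<close> is the free algebra on \<open>'g\<close>.\<close>

datatype 'g word = Word (letters: "'g list")

instantiation word :: (type) monoid_add
begin
definition zero_word :: "'a word" where "0 = Word []"
definition plus_word :: "'a word \<Rightarrow> 'a word \<Rightarrow> 'a word" where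
  "u + v = Word (letters u @ letters v)"
instance by standard (auto simp: zero_word_def plus_word_def)
end

text \<open>The constructor \<open>GD m\<close> is the generator \<open>\<delta>\<close> of index \<open>m + 1\<close>.\<close>

datatype h1_gen = GX | GY | GD nat

definition free_gen :: "'g \<Rightarrow> 'g word \<Rightarrow>\<^sub>0 complex" where
  "free_gen g = Poly_Mapping.single (Word [g]) 1"

definition h1_relators :: "(h1_gen word \<Rightarrow>\<^sub>0 complex) set" where
  "h1_relators =
     {free_gen GY * free_gen GX - free_gen GX * free_gen GY - free_gen GX} \<union>
     {free_gen GY * free_gen (GD m) - free_gen (GD m) * free_gen GY
        - of_nat (Suc m) * free_gen (GD m) | m. True} \<union>
     {free_gen GX * free_gen (GD m) - free_gen (GD m) * free_gen GX
        - free_gen (GD (Suc m)) | m. True} \<union>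
     {free_gen (GD k) * free_gen (GD l) - free_gen (GD l) * free_gen (GD k) | k l. True}"

quotient_type h1 = "h1_gen word \<Rightarrow>\<^sub>0 complex"
  / "\<lambda>p q. p - q \<in> two_sided_ideal h1_relators"
  by (rule equivp_ideal)

instantiation h1 :: complex_algebra
begin
lift_definition zero_h1 :: h1 is 0 .
lift_definition one_h1 :: h1 is 1 .
lift_definition plus_h1 :: "h1 \<Rightarrow> h1 \<Rightarrow> h1" is "(+)" by (rule ideal_cong_add)
lift_definition minus_h1 :: "h1 \<Rightarrow> h1 \<Rightarrow> h1" is "(-)" by (rule ideal_cong_minus)
lift_definition uminus_h1 :: "h1 \<Rightarrow> h1" is uminus by (rule ideal_cong_uminus)
lift_definition times_h1 :: "h1 \<Rightarrow> h1 \<Rightarrow> h1" is "(*)" by (rule ideal_cong_mult)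
lift_definition cscale_h1 :: "complex \<Rightarrow> h1 \<Rightarrow> h1" is "\<lambda>c p. Poly_Mapping.single 0 c * p"
  by (metis ideal_mult_left right_diff_distrib)
instance
  by standard
     (transfer, rule ideal_eqI, rule scalar_axioms ring_laws)+
end

lift_definition h1_of_gen :: "h1_gen \<Rightarrow> h1" is free_gen .

abbreviation "h1_X \<equiv> h1_of_gen GX"
abbreviation "h1_Y \<equiv> h1_of_gen GY"
abbreviation "h1_delta m \<equiv> h1_of_gen (GD m)"
abbreviation "h1_delta1 \<equiv> h1_of_gen (GD 0)"

text \<open>
  The tensor product of two complex algebras: the monoid algebra of the multiplicative monoid
  \<open>'a \<times> 'b\<close>, that is, the vector space freely spanned by the pairs with
  \<open>(a, b) (a', b') = (a a', b b')\<close>, modulo bilinearity.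
\<close>

datatype 'a multiplicative = Mult (unmult: 'a)

instantiation multiplicative :: (monoid_mult) monoid_add
begin
definition zero_multiplicative :: "'a multiplicative" where "0 = Mult 1"
definition plus_multiplicative ::
    "'a multiplicative \<Rightarrow> 'a multiplicative \<Rightarrow> 'a multiplicative" where
  "u + v = Mult (unmult u * unmult v)"
instance by standard (auto simp: zero_multiplicative_def plus_multiplicative_def mult.assoc)
end

definition free_pair ::
    "'a \<Rightarrow> 'b \<Rightarrow> 'a::complex_algebra multiplicative \<times> 'b::complex_algebra multiplicative \<Rightarrow>\<^sub>0 complex"
  where "free_pair a b = Poly_Mapping.single (Mult a, Mult b) 1"

definition tensor_relators ::
    "('a::complex_algebra multiplicative \<times> 'b::complex_algebra multiplicative \<Rightarrow>\<^sub>0 complex) set"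
  where
  "tensor_relators =
     {free_pair (a + a') b - free_pair a b - free_pair a' b | a a' b. True} \<union>
     {free_pair a (b + b') - free_pair a b - free_pair a b' | a b b'. True} \<union>
     {free_pair (c *c a) b - Poly_Mapping.single 0 c * free_pair a b | c a b. True} \<union>
     {free_pair a (c *c b) - Poly_Mapping.single 0 c * free_pair a b | c a b. True}"

quotient_type (overloaded) ('a, 'b) tensor =
    "'a::complex_algebra multiplicative \<times> 'b::complex_algebra multiplicative \<Rightarrow>\<^sub>0 complex"
  / "\<lambda>p q. p - q \<in> two_sided_ideal tensor_relators"
  by (rule equivp_ideal)

instantiation tensor :: (complex_algebra, complex_algebra) complex_algebra
begin
lift_definition zero_tensor :: "('a, 'b) tensor" is 0 .
lift_definition one_tensor :: "('a, 'b) tensor" is 1 .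
lift_definition plus_tensor :: "('a, 'b) tensor \<Rightarrow> ('a, 'b) tensor \<Rightarrow> ('a, 'b) tensor" is "(+)"
  by (rule ideal_cong_add)
lift_definition minus_tensor :: "('a, 'b) tensor \<Rightarrow> ('a, 'b) tensor \<Rightarrow> ('a, 'b) tensor" is "(-)"
  by (rule ideal_cong_minus)
lift_definition uminus_tensor :: "('a, 'b) tensor \<Rightarrow> ('a, 'b) tensor" is uminus
  by (rule ideal_cong_uminus)
lift_definition times_tensor :: "('a, 'b) tensor \<Rightarrow> ('a, 'b) tensor \<Rightarrow> ('a, 'b) tensor" is "(*)"
  by (rule ideal_cong_mult)
lift_definition cscale_tensor :: "complex \<Rightarrow> ('a, 'b) tensor \<Rightarrow> ('a, 'b) tensor"
  is "\<lambda>c p. Poly_Mapping.single 0 c * p"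
  by (metis ideal_mult_left right_diff_distrib)
instance
  by standard
     (transfer, rule ideal_eqI, rule scalar_axioms ring_laws)+
end

lift_definition pure_tensor :: "'a::complex_algebra \<Rightarrow> 'b::complex_algebra \<Rightarrow> ('a, 'b) tensor"
  (infixr "\<otimes>" 72) is free_pair .

lemma pure_tensor_add_left: "(a + a') \<otimes> b = a \<otimes> b + a' \<otimes> b"
  by transfer (rule ideal_rel, unfold tensor_relators_def diff_diff_eq[symmetric], blast)

lemma pure_tensor_add_right: "a \<otimes> (b + b') = a \<otimes> b + a \<otimes> b'"
  by transfer (rule ideal_rel, unfold tensor_relators_def diff_diff_eq[symmetric], blast)

lemma pure_tensor_cscale_left: "(c *c a) \<otimes> b = c *c (a \<otimes> b)"
  by transfer (rule ideal_rel, unfold tensor_relators_def, blast)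

lemma pure_tensor_cscale_right: "a \<otimes> (c *c b) = c *c (a \<otimes> b)"
  by transfer (rule ideal_rel, unfold tensor_relators_def, blast)

lemma pure_tensor_mult: "(a \<otimes> b) * (a' \<otimes> b') = (a * a') \<otimes> (b * b')"
  by transfer (rule ideal_eqI, simp add: free_pair_def mult_single plus_multiplicative_def)

lemma pure_tensor_one: "1 \<otimes> 1 = 1"
  by transfer (rule ideal_eqI, simp add: free_pair_def zero_prod_def zero_multiplicative_def
      flip: single_one)

lemma sum_list_pure_tensor:
  fixes t :: "('a::complex_algebra, 'b::complex_algebra) tensor"
  shows "\<exists>us. t = (\<Sum>(a, b)\<leftarrow>us. a \<otimes> b)"
proof -
  define P :: "('a, 'b) tensor \<Rightarrow> bool" where "P t \<longleftrightarrow> (\<exists>us. t = (\<Sum>(a, b)\<leftarrow>us. a \<otimes> b))" for t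
  have "P (abs_tensor p)" for p
  proof (induction p rule: poly_mapping_single_induct)
    case zero
    have "abs_tensor 0 = (\<Sum>(a, b)\<leftarrow>[]. (a::'a) \<otimes> (b::'b))" by (simp add: zero_tensor_def)
    then show ?case unfolding P_def by blast
  next
    case (single k c)
    obtain a b where k: "k = (Mult a, Mult b)" by (metis multiplicative.exhaust prod.exhaust)
    have "abs_tensor (Poly_Mapping.single k c) = c *c (a \<otimes> b)"
      by (simp add: k pure_tensor.abs_eq cscale_tensor.abs_eq free_pair_def mult_single)
    then have "abs_tensor (Poly_Mapping.single k c) = (\<Sum>(a, b)\<leftarrow>[(c *c a, b)]. a \<otimes> b)"
      by (simp add: pure_tensor_cscale_left)
    then show ?case unfolding P_def by blast
  next
    case (add p q)
    then obtain us vs where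
      "abs_tensor p = (\<Sum>(a, b)\<leftarrow>us. a \<otimes> b)" "abs_tensor q = (\<Sum>(a, b)\<leftarrow>vs. a \<otimes> b)"
      unfolding P_def by blast
    then have "abs_tensor (p + q) = (\<Sum>(a, b)\<leftarrow>us @ vs. a \<otimes> b)"
      by (simp flip: plus_tensor.abs_eq)
    then show ?case unfolding P_def by blast
  qed
  then have "P t" by (rule tensor.abs_induct[of P])
  then show ?thesis unfolding P_def .
qed

definition coproduct :: "h1 \<Rightarrow> (h1, h1) tensor" where
  "coproduct = (THE \<Delta>. alg_hom \<Delta> \<and>
     \<Delta> h1_Y = h1_Y \<otimes> 1 + 1 \<otimes> h1_Y \<and>
     \<Delta> h1_delta1 = h1_delta1 \<otimes> 1 + 1 \<otimes> h1_delta1 \<and>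
     \<Delta> h1_X = h1_X \<otimes> 1 + 1 \<otimes> h1_X + h1_delta1 \<otimes> h1_Y)"

definition counit :: "h1 \<Rightarrow> complex" where
  "counit = (THE \<epsilon>. alg_hom \<epsilon> \<and> (\<forall>g. \<epsilon> (h1_of_gen g) = 0))"

definition modular_character :: "h1 \<Rightarrow> complex" where
  "modular_character = (THE \<delta>. alg_hom \<delta> \<and> \<delta> h1_Y = 1 \<and> \<delta> h1_X = 0 \<and> (\<forall>m. \<delta> (h1_delta m) = 0))"

text \<open>
  The three definite descriptions are proper: see \<open>coproduct_exists_unique\<close>,
  \<open>counit_exists_unique\<close> and \<open>modular_character_exists_unique\<close> below.
\<close>

lemma cscale_zero_right: "c *c (0::'a::complex_algebra) = 0"
  using cscale_add_right[of c "0::'a" 0] by simp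

lemma cscale_zero_left: "0 *c (x::'a::complex_algebra) = 0"
  using cscale_add_left[of 0 0 x] by simp

lemma cscale_minus_left: "(- c) *c (x::'a::complex_algebra) = - (c *c x)"
  using cscale_add_left[of c "-c" x] by (simp add: cscale_zero_left eq_neg_iff_add_eq_0 add.commute)

lemma alg_hom_minus: "alg_hom F \<Longrightarrow> F (x - y) = F x - F y"
  unfolding alg_hom_def by (metis add_diff_cancel diff_add_cancel)

lemma alg_hom_zero: "alg_hom F \<Longrightarrow> F 0 = 0"
  using alg_hom_minus[of F 0 0] by simp

definition free_lift :: "('g \<Rightarrow> 'b::complex_algebra) \<Rightarrow> ('g word \<Rightarrow>\<^sub>0 complex) \<Rightarrow> 'b" where
  "free_lift \<phi> p =
     (\<Sum>w\<in>Poly_Mapping.keys p. Poly_Mapping.lookup p w *c prod_list (map \<phi> (letters w)))"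

lemma free_lift_zero: "free_lift \<phi> 0 = 0"
  by (simp add: free_lift_def)

lemma free_lift_superset:
  "finite W \<Longrightarrow> Poly_Mapping.keys p \<subseteq> W \<Longrightarrow>
    free_lift \<phi> p = (\<Sum>w\<in>W. Poly_Mapping.lookup p w *c prod_list (map \<phi> (letters w)))"
  unfolding free_lift_def
  by (rule sum.mono_neutral_left) (auto simp: in_keys_iff cscale_zero_left)

lemma free_lift_add: "free_lift \<phi> (p + q) = free_lift \<phi> p + free_lift \<phi> q"
proof -
  let ?W = "Poly_Mapping.keys p \<union> Poly_Mapping.keys q"
  have "free_lift \<phi> r = (\<Sum>w\<in>?W. Poly_Mapping.lookup r w *c prod_list (map \<phi> (letters w)))"
    if "Poly_Mapping.keys r \<subseteq> ?W" for r
    by (rule free_lift_superset) (use that in auto)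
  then show ?thesis
    by (simp add: keys_add lookup_add cscale_add_left sum.distrib)
qed

lemma free_lift_single:
  "free_lift \<phi> (Poly_Mapping.single w c) = c *c prod_list (map \<phi> (letters w))"
  by (simp add: free_lift_def cscale_zero_left)

lemma free_lift_mult: "free_lift \<phi> (p * q) = free_lift \<phi> p * free_lift \<phi> q"
proof (induction p rule: poly_mapping_single_induct)
  case (single u c)
  show ?case
    by (induction q rule: poly_mapping_single_induct)
       (simp_all add: free_lift_add free_lift_single mult_single plus_word_def cscale_mult_left
          cscale_mult_right cscale_cscale cscale_zero_right distrib_left free_lift_zero
          mult.commute[of c])
qed (simp_all add: free_lift_add distrib_right free_lift_zero)

lemma free_lift_uminus: "free_lift \<phi> (- p) = - free_lift \<phi> p"
  using free_lift_add[of \<phi> p "-p"] by (simp add: free_lift_zero eq_neg_iff_add_eq_0 add.commute)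

lemma free_lift_diff: "free_lift \<phi> (p - q) = free_lift \<phi> p - free_lift \<phi> q"
  using free_lift_add[of \<phi> p "-q"] by (simp add: free_lift_uminus)

lemma free_lift_gen: "free_lift \<phi> (free_gen g) = \<phi> g"
  by (simp add: free_gen_def free_lift_single cscale_one)

lemma free_lift_of_nat: "free_lift \<phi> (of_nat n) = of_nat n *c 1"
proof -
  have "free_lift \<phi> 1 = 1"
    by (simp add: free_lift_single zero_word_def cscale_one flip: single_one)
  then show ?thesis
    by (induction n) (simp_all add: free_lift_add free_lift_zero cscale_add_left cscale_one
        cscale_zero_left)
qed

lemma free_lift_ideal:
  assumes "\<And>r. r \<in> R \<Longrightarrow> free_lift \<phi> r = 0" "p \<in> two_sided_ideal R"
  shows "free_lift \<phi> p = 0"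
  using assms(2)
  by induction (simp_all add: free_lift_add free_lift_mult free_lift_zero assms(1))

definition h1_compatible :: "(h1_gen \<Rightarrow> 'b::complex_algebra) \<Rightarrow> bool" where
  "h1_compatible \<phi> \<longleftrightarrow>
     \<phi> GY * \<phi> GX - \<phi> GX * \<phi> GY = \<phi> GX \<and>
     (\<forall>m. \<phi> GY * \<phi> (GD m) - \<phi> (GD m) * \<phi> GY = of_nat (Suc m) *c \<phi> (GD m)) \<and>
     (\<forall>m. \<phi> GX * \<phi> (GD m) - \<phi> (GD m) * \<phi> GX = \<phi> (GD (Suc m))) \<and>
     (\<forall>k l. \<phi> (GD k) * \<phi> (GD l) = \<phi> (GD l) * \<phi> (GD k))"

lemma h1_lift_exists:
  fixes \<phi> :: "h1_gen \<Rightarrow> 'b::complex_algebra"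
  assumes "h1_compatible \<phi>"
  shows "\<exists>F. alg_hom F \<and> (\<forall>g. F (h1_of_gen g) = \<phi> g)"
proof -
  have rel: "free_lift \<phi> r = 0" if "r \<in> h1_relators" for r
    using that assms unfolding h1_relators_def h1_compatible_def
    by (auto simp: free_lift_diff free_lift_mult free_lift_gen free_lift_of_nat cscale_mult_left
             simp del: of_nat_Suc)
  define F where "F x = free_lift \<phi> (rep_h1 x)" for x
  have F_abs: "F (abs_h1 p) = free_lift \<phi> p" for p
  proof -
    have "rep_h1 (abs_h1 p) - p \<in> two_sided_ideal h1_relators"
      using Quotient_rep_abs[OF Quotient_h1, of p] two_sided_ideal.zero by auto
    from free_lift_ideal[of h1_relators \<phi>, OF rel this] show ?thesis
      by (simp add: F_def free_lift_diff)
  qed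
  have ex: "\<exists>p. x = abs_h1 p" for x by (rule h1.abs_induct) blast
  have "alg_hom F" unfolding alg_hom_def
  proof (intro conjI allI)
    fix x y c
    obtain p q where [simp]: "x = abs_h1 p" "y = abs_h1 q" using ex by meson
    show "F (x + y) = F x + F y" by (simp add: plus_h1.abs_eq F_abs free_lift_add)
    show "F (x * y) = F x * F y" by (simp add: times_h1.abs_eq F_abs free_lift_mult)
    show "F (c *c x) = c *c F x"
      by (simp add: cscale_h1.abs_eq F_abs free_lift_mult free_lift_single zero_word_def
            cscale_mult_left)
    show "F 1 = 1"
      by (simp add: one_h1_def F_abs free_lift_single zero_word_def cscale_one flip: single_one)
  qed
  moreover have "F (h1_of_gen g) = \<phi> g" for g
    by (simp add: h1_of_gen.abs_eq F_abs free_lift_gen)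
  ultimately show ?thesis by blast
qed

lemma alg_hom_eqI:
  assumes F: "alg_hom F" and G: "alg_hom G" and gen: "\<And>g. F (h1_of_gen g) = G (h1_of_gen g)"
  shows "F = (G :: h1 \<Rightarrow> 'b::complex_algebra)"
proof
  fix x
  have word: "F (abs_h1 (Poly_Mapping.single (Word gs) 1))
      = G (abs_h1 (Poly_Mapping.single (Word gs) 1))" for gs
  proof (induction gs)
    case Nil
    have "abs_h1 (Poly_Mapping.single (Word []) 1) = 1"
      by (simp add: one_h1_def flip: single_one zero_word_def)
    then show ?case using F G by (simp add: alg_hom_def)
  next
    case (Cons g gs)
    have "abs_h1 (Poly_Mapping.single (Word (g # gs)) 1)
        = h1_of_gen g * abs_h1 (Poly_Mapping.single (Word gs) 1)"
      by (simp add: h1_of_gen.abs_eq times_h1.abs_eq free_gen_def mult_single plus_word_def)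
    then show ?case using F G Cons gen by (simp add: alg_hom_def)
  qed
  have "F (abs_h1 p) = G (abs_h1 p)" for p
  proof (induction p rule: poly_mapping_single_induct)
    case zero
    then show ?case using alg_hom_zero[OF F] alg_hom_zero[OF G] by (simp flip: zero_h1_def)
  next
    case (single w c)
    have "abs_h1 (Poly_Mapping.single w c) = c *c abs_h1 (Poly_Mapping.single (Word (letters w)) 1)"
      by (simp add: cscale_h1.abs_eq mult_single)
    then show ?case using F G word[of "letters w"] by (simp add: alg_hom_def)
  next
    case (add p q)
    then show ?case using F G by (simp add: alg_hom_def flip: plus_h1.abs_eq)
  qed
  then show "F x = G x" by (rule h1.abs_induct[of "\<lambda>x. F x = G x"])
qed

lemma h1_of_gen_compatible: "h1_compatible h1_of_gen"
proof -
  have abs: "abs_h1 p = abs_h1 q" if "p - q \<in> h1_relators" for p q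
    using ideal_rel[OF that] by (simp add: h1.abs_eq_iff)
  have nat: "of_nat n *c abs_h1 p = abs_h1 (of_nat n * p)" for n p
    by (simp add: cscale_h1.abs_eq single_of_nat)
  show ?thesis
    unfolding h1_compatible_def h1_of_gen.abs_eq times_h1.abs_eq minus_h1.abs_eq nat
    by (intro conjI allI abs; unfold h1_relators_def; blast)
qed

lemma delta_Suc: "h1_delta (Suc m) = h1_X * h1_delta m - h1_delta m * h1_X"
  using h1_of_gen_compatible by (simp add: h1_compatible_def)

lemma counit_exists_unique: "\<exists>!\<epsilon>::h1 \<Rightarrow> complex. alg_hom \<epsilon> \<and> (\<forall>g. \<epsilon> (h1_of_gen g) = 0)"
proof -
  have "h1_compatible (\<lambda>_. 0 :: complex)" by (simp add: h1_compatible_def cscale_complex_def)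
  from h1_lift_exists[OF this] show ?thesis by (auto intro: alg_hom_eqI)
qed

lemma modular_character_exists_unique:
  "\<exists>!\<delta>::h1 \<Rightarrow> complex. alg_hom \<delta> \<and> \<delta> h1_Y = 1 \<and> \<delta> h1_X = 0 \<and> (\<forall>m. \<delta> (h1_delta m) = 0)"
proof -
  let ?\<phi> = "\<lambda>g. if g = GY then 1 else (0 :: complex)"
  have "h1_compatible ?\<phi>" by (simp add: h1_compatible_def cscale_complex_def)
  from h1_lift_exists[OF this]
  obtain F :: "h1 \<Rightarrow> complex" where F: "alg_hom F" "\<And>g. F (h1_of_gen g) = ?\<phi> g"
    by blast
  show ?thesis
  proof (rule ex1I[of _ F])
    fix G :: "h1 \<Rightarrow> complex"
    assume G: "alg_hom G \<and> G h1_Y = 1 \<and> G h1_X = 0 \<and> (\<forall>m. G (h1_delta m) = 0)"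
    have "G (h1_of_gen g) = F (h1_of_gen g)" for g by (cases g) (use G F in auto)
    then show "G = F" using G F(1) by (intro alg_hom_eqI) auto
  qed (use F in auto)
qed

lemma pure_tensor_minus_left: "(a - a') \<otimes> b = a \<otimes> b - a' \<otimes> b"
  by (metis add_diff_cancel diff_add_cancel pure_tensor_add_left)

lemma pure_tensor_minus_right: "a \<otimes> (b - b') = a \<otimes> b - a \<otimes> b'"
  by (metis add_diff_cancel diff_add_cancel pure_tensor_add_right)

inductive_set delta_algebra :: "h1 set" where
  gen: "h1_delta m \<in> delta_algebra"
| one: "1 \<in> delta_algebra"
| add: "p \<in> delta_algebra \<Longrightarrow> q \<in> delta_algebra \<Longrightarrow> p + q \<in> delta_algebra"
| mult: "p \<in> delta_algebra \<Longrightarrow> q \<in> delta_algebra \<Longrightarrow> p * q \<in> delta_algebra"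
| cscale: "p \<in> delta_algebra \<Longrightarrow> c *c p \<in> delta_algebra"

lemma commute_mult:
  fixes x y z :: "'a::complex_algebra"
  assumes "x * z = z * x" "y * z = z * y"
  shows "x * y * z = z * (x * y)"
  by (metis assms mult.assoc)

lemma delta_algebra_commute:
  assumes "p \<in> delta_algebra" "q \<in> delta_algebra"
  shows "p * q = q * p"
  using assms
proof (induction p)
  case (gen m)
  from gen(1) show ?case
  proof (induction q)
    case (gen n)
    then show ?case using h1_of_gen_compatible by (simp add: h1_compatible_def)
  next
    case (mult p q)
    then show ?case using commute_mult[of p "h1_delta m" q] by simp
  qed (simp_all add: distrib_left distrib_right cscale_mult_left cscale_mult_right)
next
  case (mult p p')
  then show ?case using commute_mult[of p q p'] by simp
qed (simp_all add: distrib_left distrib_right cscale_mult_left cscale_mult_right)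

lemma cscale_minus_right: "c *c (x - y) = c *c x - c *c (y::'a::complex_algebra)"
  by (metis add_diff_cancel diff_add_cancel cscale_add_right)

lemma derivation_closed:
  fixes d :: h1
  assumes "\<And>m. d * h1_delta m - h1_delta m * d \<in> delta_algebra" "p \<in> delta_algebra"
  shows "d * p - p * d \<in> delta_algebra"
  using assms(2)
proof induction
  case one
  have "0 *c (1::h1) \<in> delta_algebra" by (intro delta_algebra.intros)
  then show ?case by (simp add: cscale_zero_left)
next
  case (add p q)
  have "d * (p + q) - (p + q) * d = (d * p - p * d) + (d * q - q * d)"
    by (simp add: algebra_simps)
  then show ?case using add by (simp add: delta_algebra.add)
next
  case (mult p q)
  have "d * (p * q) - p * q * d = (d * p - p * d) * q + p * (d * q - q * d)"
    by (simp add: algebra_simps)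
  then show ?case using mult by (simp add: delta_algebra.add delta_algebra.mult)
next
  case (cscale p c)
  have "d * (c *c p) - (c *c p) * d = c *c (d * p - p * d)"
    by (simp add: cscale_mult_left cscale_mult_right cscale_minus_right)
  then show ?case using cscale by (simp add: delta_algebra.cscale)
qed (rule assms(1))

lemma delta_algebra_X: "p \<in> delta_algebra \<Longrightarrow> h1_X * p - p * h1_X \<in> delta_algebra"
  by (rule derivation_closed) (simp_all add: delta_algebra.gen flip: delta_Suc)

lemma delta_algebra_Y: "p \<in> delta_algebra \<Longrightarrow> h1_Y * p - p * h1_Y \<in> delta_algebra"
  by (rule derivation_closed)
     (use h1_of_gen_compatible in \<open>simp_all add: h1_compatible_def delta_algebra.intros\<close>)

inductive_set delta_tensors :: "(h1, h1) tensor set" where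
  pure: "p \<in> delta_algebra \<Longrightarrow> q \<in> delta_algebra \<Longrightarrow> p \<otimes> q \<in> delta_tensors"
| add: "s \<in> delta_tensors \<Longrightarrow> t \<in> delta_tensors \<Longrightarrow> s + t \<in> delta_tensors"

lemma delta_tensors_commute:
  assumes "s \<in> delta_tensors" "t \<in> delta_tensors"
  shows "s * t = t * s"
  using assms
proof (induction s)
  case (pure p q)
  from pure(3,1,2) show ?case
    by (induction t) (simp_all add: pure_tensor_mult delta_algebra_commute distrib_left distrib_right)
qed (simp_all add: distrib_left distrib_right)

definition coproduct_X :: "(h1, h1) tensor" where
  "coproduct_X = h1_X \<otimes> 1 + 1 \<otimes> h1_X + h1_delta1 \<otimes> h1_Y"

definition coproduct_Y :: "(h1, h1) tensor" where
  "coproduct_Y = h1_Y \<otimes> 1 + 1 \<otimes> h1_Y"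

primrec coproduct_delta :: "nat \<Rightarrow> (h1, h1) tensor" where
  "coproduct_delta 0 = h1_delta1 \<otimes> 1 + 1 \<otimes> h1_delta1"
| "coproduct_delta (Suc m) = coproduct_X * coproduct_delta m - coproduct_delta m * coproduct_X"

lemma delta_tensors_X:
  assumes "t \<in> delta_tensors" shows "coproduct_X * t - t * coproduct_X \<in> delta_tensors"
  using assms
proof induction
  case (pure p q)
  have 1: "h1_delta1 * p = p * h1_delta1"
    by (rule delta_algebra_commute) (use pure in \<open>auto intro: delta_algebra.gen\<close>)
  have "coproduct_X * (p \<otimes> q) - (p \<otimes> q) * coproduct_X =
      (h1_X * p - p * h1_X) \<otimes> q + p \<otimes> (h1_X * q - q * h1_X)
        + (h1_delta1 * p) \<otimes> (h1_Y * q - q * h1_Y)"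
    by (simp add: coproduct_X_def distrib_left distrib_right pure_tensor_mult
          pure_tensor_minus_left pure_tensor_minus_right 1)
  then show ?case
    using pure by (simp add: delta_tensors.intros delta_algebra.intros delta_algebra_X delta_algebra_Y)
next
  case (add s t)
  have "coproduct_X * (s + t) - (s + t) * coproduct_X =
      (coproduct_X * s - s * coproduct_X) + (coproduct_X * t - t * coproduct_X)"
    by (simp add: algebra_simps)
  then show ?case using add by (simp add: delta_tensors.add)
qed

lemma coproduct_delta_in: "coproduct_delta m \<in> delta_tensors"
  by (induction m) (auto intro: delta_tensors.intros delta_algebra.intros delta_tensors_X)

lemma coproduct_XY: "coproduct_Y * coproduct_X - coproduct_X * coproduct_Y = coproduct_X"
proof -
  have YX: "h1_Y * h1_X = h1_X * h1_Y + h1_X"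
    using h1_of_gen_compatible by (simp add: h1_compatible_def algebra_simps)
  have "h1_Y * h1_delta1 - h1_delta1 * h1_Y = h1_delta1"
    using h1_of_gen_compatible by (auto simp: h1_compatible_def cscale_one dest: spec[of _ 0])
  then have Yd: "h1_Y * h1_delta1 = h1_delta1 * h1_Y + h1_delta1"
    by (simp add: algebra_simps)
  show ?thesis
    by (simp add: coproduct_X_def coproduct_Y_def distrib_left distrib_right pure_tensor_mult YX Yd
          pure_tensor_add_left pure_tensor_add_right)
qed

lemma coproduct_Y_delta:
  "coproduct_Y * coproduct_delta m - coproduct_delta m * coproduct_Y
    = of_nat (Suc m) *c coproduct_delta m"
proof (induction m)
  case 0
  have "h1_Y * h1_delta1 - h1_delta1 * h1_Y = h1_delta1"
    using h1_of_gen_compatible by (auto simp: h1_compatible_def cscale_one dest: spec[of _ 0])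
  then have "h1_Y * h1_delta1 = h1_delta1 * h1_Y + h1_delta1"
    by (simp add: algebra_simps)
  then show ?case
    by (simp add: coproduct_Y_def distrib_left distrib_right pure_tensor_mult cscale_one
          pure_tensor_add_left pure_tensor_add_right)
next
  case (Suc m)
  let ?X = coproduct_X and ?Y = coproduct_Y and ?d = "coproduct_delta m"
  have "?Y * (?X * ?d - ?d * ?X) - (?X * ?d - ?d * ?X) * ?Y
      = ((?Y * ?X - ?X * ?Y) * ?d - ?d * (?Y * ?X - ?X * ?Y))
        + (?X * (?Y * ?d - ?d * ?Y) - (?Y * ?d - ?d * ?Y) * ?X)"
    by (simp add: algebra_simps)
  also have "\<dots> = (?X * ?d - ?d * ?X) + of_nat (Suc m) *c (?X * ?d - ?d * ?X)"
    unfolding Suc coproduct_XY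
    by (simp only: cscale_mult_left cscale_mult_right cscale_minus_right)
  also have "\<dots> = of_nat (Suc (Suc m)) *c (?X * ?d - ?d * ?X)"
    using cscale_add_left[of 1 "of_nat (Suc m)" "?X * ?d - ?d * ?X"] by (simp add: cscale_one)
  finally show ?case by simp
qed

lemma coproduct_exists_unique:
  "\<exists>!\<Delta>. alg_hom \<Delta> \<and>
     \<Delta> h1_Y = h1_Y \<otimes> 1 + 1 \<otimes> h1_Y \<and>
     \<Delta> h1_delta1 = h1_delta1 \<otimes> 1 + 1 \<otimes> h1_delta1 \<and>
     \<Delta> h1_X = h1_X \<otimes> 1 + 1 \<otimes> h1_X + h1_delta1 \<otimes> h1_Y"
proof -
  let ?\<phi> = "case_h1_gen coproduct_X coproduct_Y coproduct_delta"
  have "h1_compatible ?\<phi>"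
    by (simp add: h1_compatible_def coproduct_XY coproduct_Y_delta del: of_nat_Suc)
       (simp add: delta_tensors_commute coproduct_delta_in)
  from h1_lift_exists[OF this]
  obtain F where F: "alg_hom F" "\<And>g. F (h1_of_gen g) = ?\<phi> g"
    by blast
  show ?thesis
  proof (rule ex1I[of _ F])
    fix G assume G: "alg_hom G \<and>
     G h1_Y = h1_Y \<otimes> 1 + 1 \<otimes> h1_Y \<and>
     G h1_delta1 = h1_delta1 \<otimes> 1 + 1 \<otimes> h1_delta1 \<and>
     G h1_X = h1_X \<otimes> 1 + 1 \<otimes> h1_X + h1_delta1 \<otimes> h1_Y"
    then have hom: "alg_hom G" and X: "G h1_X = coproduct_X" by (simp_all add: coproduct_X_def)
    have "G (h1_delta m) = coproduct_delta m" for m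
    proof (induction m)
      case (Suc m)
      then show ?case
        using hom X unfolding delta_Suc by (simp add: alg_hom_minus) (simp add: alg_hom_def)
    qed (use G in simp)
    then have "G (h1_of_gen g) = F (h1_of_gen g)" for g
      by (cases g) (use G F in \<open>auto simp: coproduct_X_def coproduct_Y_def\<close>)
    then show "G = F" using hom F(1) by (intro alg_hom_eqI)
  qed (use F in \<open>simp add: coproduct_X_def coproduct_Y_def\<close>)
qed


section \<open>Modular forms of all levels\<close>

abbreviation upper_half_plane :: "complex set" where
  "upper_half_plane \<equiv> {z. Im z > 0}"

definition GL2Q_pos :: "(rat^2^2) set" where
  "GL2Q_pos = {\<gamma>. det \<gamma> > 0}"

definition SL2Z :: "(rat^2^2) set" where
  "SL2Z = {\<gamma>. det \<gamma> = 1 \<and> (\<forall>i j. \<gamma> $ i $ j \<in> \<int>)}"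

definition Gamma_level :: "nat \<Rightarrow> (rat^2^2) set" where
  "Gamma_level N = {\<gamma> \<in> SL2Z. \<forall>i j. \<exists>m::int. \<gamma> $ i $ j - mat 1 $ i $ j = of_int m * of_nat N}"

definition moebius_denom :: "rat^2^2 \<Rightarrow> complex \<Rightarrow> complex" where
  "moebius_denom \<gamma> z = of_rat (\<gamma> $ 2 $ 1) * z + of_rat (\<gamma> $ 2 $ 2)"

definition moebius :: "rat^2^2 \<Rightarrow> complex \<Rightarrow> complex" where
  "moebius \<gamma> z = (of_rat (\<gamma> $ 1 $ 1) * z + of_rat (\<gamma> $ 1 $ 2)) / moebius_denom \<gamma> z"

text \<open>
  Functions on the upper half plane are represented by functions on the plane that vanish off it,
  so that equality of functions has its intended meaning.
\<close>

definition on_uhp :: "(complex \<Rightarrow> complex) \<Rightarrow> complex \<Rightarrow> complex" where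
  "on_uhp f z = (if z \<in> upper_half_plane then f z else 0)"

definition slash :: "int \<Rightarrow> (complex \<Rightarrow> complex) \<Rightarrow> rat^2^2 \<Rightarrow> complex \<Rightarrow> complex" where
  "slash k f \<gamma> = on_uhp (\<lambda>z.
     of_real (real_of_rat (det \<gamma>) powr (of_int k / 2)) * moebius_denom \<gamma> z powi (- k) * f (moebius \<gamma> z))"

text \<open>Holomorphy at the cusps is boundedness of every \<open>SL\<^sub>2(\<int>)\<close>-translate near \<open>i\<infinity>\<close>.\<close>

definition modular_forms_level :: "nat \<Rightarrow> int \<Rightarrow> (complex \<Rightarrow> complex) set" where
  "modular_forms_level N k = {f.
     f holomorphic_on upper_half_plane \<and> (\<forall>z. z \<notin> upper_half_plane \<longrightarrow> f z = 0) \<and>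
     (\<forall>\<gamma>\<in>Gamma_level N. slash k f \<gamma> = f) \<and>
     (\<forall>\<gamma>\<in>SL2Z. \<exists>B C. \<forall>z. Im z \<ge> B \<longrightarrow> norm (slash k f \<gamma> z) \<le> C)}"

definition modular_forms :: "int \<Rightarrow> (complex \<Rightarrow> complex) set" where
  "modular_forms k = (\<Union>N\<in>{1..}. modular_forms_level N k)"


section \<open>The crossed product\<close>

text \<open>
  An element of the crossed product is a finitely supported family indexed by a weight \<open>k\<close> and a
  matrix \<open>\<gamma>\<close>; the entry at \<open>(k, \<gamma>)\<close> is the weight \<open>k\<close> component of the coefficient of
  \<open>U\<^sub>\<gamma>\<close>. The monomial \<open>f U\<^sub>\<gamma>\<close> with \<open>f\<close> of weight \<open>k\<close> is \<open>monomial k f \<gamma>\<close>. The product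
  is \<open>\<odot>\<close> below, not the convolution that \<open>Poly_Mapping\<close> derives from addition of matrices.
\<close>

type_synonym crossed = "int \<times> (rat^2^2) \<Rightarrow>\<^sub>0 (complex \<Rightarrow> complex)"

definition crossed_product :: "crossed set" where
  "crossed_product = {a. \<forall>k \<gamma>. (k, \<gamma>) \<in> Poly_Mapping.keys a \<longrightarrow>
     \<gamma> \<in> GL2Q_pos \<and> Poly_Mapping.lookup a (k, \<gamma>) \<in> modular_forms k}"

definition monomial :: "int \<Rightarrow> (complex \<Rightarrow> complex) \<Rightarrow> rat^2^2 \<Rightarrow> crossed" where
  "monomial k f \<gamma> = Poly_Mapping.single (k, \<gamma>) f"

definition crossed_scale :: "complex \<Rightarrow> crossed \<Rightarrow> crossed" where
  "crossed_scale c a = Poly_Mapping.map (\<lambda>f z. c * f z) a"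

definition crossed_one :: crossed where
  "crossed_one = monomial 0 (on_uhp (\<lambda>_. 1)) (mat 1)"

definition crossed_mult :: "crossed \<Rightarrow> crossed \<Rightarrow> crossed"  (infixl "\<odot>" 70) where
  "a \<odot> b = (\<Sum>(k, \<alpha>)\<in>Poly_Mapping.keys a. \<Sum>(l, \<beta>)\<in>Poly_Mapping.keys b.
     monomial (k + l)
       (\<lambda>z. Poly_Mapping.lookup a (k, \<alpha>) z *
             slash l (Poly_Mapping.lookup b (l, \<beta>)) (matrix_inv \<alpha>) z)
       (\<alpha> ** \<beta>))"


section \<open>The standard action\<close>

text \<open>
  A Sweedler sum over \<open>coproduct h\<close> is a sum over any list \<open>us\<close> of pairs with
  \<open>coproduct h = (\<Sum>(u, v)\<leftarrow>us. u \<otimes> v)\<close>. Such lists exist by \<open>sum_list_pure_tensor\<close>, and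
  bilinearity makes the result independent of the choice.
\<close>

definition hopf_action :: "(h1 \<Rightarrow> crossed \<Rightarrow> crossed) \<Rightarrow> bool" where
  "hopf_action act \<longleftrightarrow>
     (\<forall>h. \<forall>a\<in>crossed_product. act h a \<in> crossed_product) \<and>
     (\<forall>h. \<forall>a\<in>crossed_product. \<forall>b\<in>crossed_product. act h (a + b) = act h a + act h b) \<and>
     (\<forall>h c. \<forall>a\<in>crossed_product. act h (crossed_scale c a) = crossed_scale c (act h a)) \<and>
     (\<forall>g h. \<forall>a\<in>crossed_product. act (g + h) a = act g a + act h a) \<and>
     (\<forall>c h. \<forall>a\<in>crossed_product. act (c *c h) a = crossed_scale c (act h a)) \<and>
     (\<forall>a\<in>crossed_product. act 1 a = a) \<and>
     (\<forall>g h. \<forall>a\<in>crossed_product. act (g * h) a = act g (act h a)) \<and>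
     (\<forall>h us. \<forall>a\<in>crossed_product. \<forall>b\<in>crossed_product.
        coproduct h = (\<Sum>(u, v)\<leftarrow>us. u \<otimes> v) \<longrightarrow>
        act h (a \<odot> b) = (\<Sum>(u, v)\<leftarrow>us. act u a \<odot> act v b)) \<and>
     (\<forall>h. act h crossed_one = crossed_scale (counit h) crossed_one)"

definition dedekind_eta :: "complex \<Rightarrow> complex" where
  "dedekind_eta z =
     exp (of_real pi * \<i> * z / 12) * prodinf (\<lambda>n. 1 - exp (2 * of_real pi * \<i> * of_nat (Suc n) * z))"

definition eta4 :: "complex \<Rightarrow> complex" where
  "eta4 = on_uhp (\<lambda>z. dedekind_eta z ^ 4)"

text \<open>\<open>d/dz log f\<close> as the logarithmic derivative \<open>f'/f\<close>, which involves no choice of branch.\<close>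

definition dlog :: "(complex \<Rightarrow> complex) \<Rightarrow> complex \<Rightarrow> complex" where
  "dlog f z = deriv f z / f z"

definition form_X :: "int \<Rightarrow> (complex \<Rightarrow> complex) \<Rightarrow> complex \<Rightarrow> complex" where
  "form_X k f = on_uhp (\<lambda>z.
     1 / (2 * of_real pi * \<i>) * deriv f z
       - 1 / (2 * of_real pi * \<i>) * dlog eta4 z * (of_int k / 2) * f z)"

definition mu :: "rat^2^2 \<Rightarrow> complex \<Rightarrow> complex" where
  "mu \<gamma> = on_uhp (\<lambda>z. 1 / (2 * of_real pi * \<i>) * dlog (\<lambda>w. slash 2 eta4 \<gamma> w / eta4 w) z)"

definition standard_action :: "(h1 \<Rightarrow> crossed \<Rightarrow> crossed) \<Rightarrow> bool" where
  "standard_action act \<longleftrightarrow> hopf_action act \<and>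
     (\<forall>k. \<forall>f\<in>modular_forms k. \<forall>\<gamma>\<in>GL2Q_pos.
        act h1_Y (monomial k f (matrix_inv \<gamma>)) =
          crossed_scale (of_int k / 2) (monomial k f (matrix_inv \<gamma>)) \<and>
        act h1_X (monomial k f (matrix_inv \<gamma>)) = monomial (k + 2) (form_X k f) (matrix_inv \<gamma>) \<and>
        act h1_delta1 (monomial k f (matrix_inv \<gamma>)) =
          monomial (k + 2) (\<lambda>z. mu \<gamma> z * f z) (matrix_inv \<gamma>))"


section \<open>Cyclic cocycles\<close>

definition bilinear_functional :: "(crossed \<Rightarrow> crossed \<Rightarrow> complex) \<Rightarrow> bool" where
  "bilinear_functional \<tau> \<longleftrightarrow>
     (\<forall>a\<in>crossed_product. \<forall>b\<in>crossed_product. \<forall>b'\<in>crossed_product. \<forall>c.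
        \<tau> a (b + b') = \<tau> a b + \<tau> a b' \<and> \<tau> (b + b') a = \<tau> b a + \<tau> b' a \<and>
        \<tau> a (crossed_scale c b) = c * \<tau> a b \<and> \<tau> (crossed_scale c b) a = c * \<tau> b a)"

definition cyclic_cocycle :: "(crossed \<Rightarrow> crossed \<Rightarrow> complex) \<Rightarrow> bool" where
  "cyclic_cocycle \<tau> \<longleftrightarrow> bilinear_functional \<tau> \<and>
     (\<forall>a0\<in>crossed_product. \<forall>a1\<in>crossed_product. \<forall>a2\<in>crossed_product.
        \<tau> (a0 \<odot> a1) a2 - \<tau> a0 (a1 \<odot> a2) + \<tau> (a2 \<odot> a0) a1 = 0) \<and>
     (\<forall>a0\<in>crossed_product. \<forall>a1\<in>crossed_product. \<tau> a0 a1 = - \<tau> a1 a0)"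

text \<open>
  The integrand is holomorphic on the convex upper half plane, so the integral does not depend on
  the path; it is taken along the segment.
\<close>

definition tau0_monomial ::
  "complex \<Rightarrow> int \<Rightarrow> (complex \<Rightarrow> complex) \<Rightarrow> rat^2^2 \<Rightarrow> int \<Rightarrow> (complex \<Rightarrow> complex) \<Rightarrow> rat^2^2 \<Rightarrow> complex"
  where
  "tau0_monomial z0 k f \<alpha> l g \<beta> =
     (if k + l = 2 \<and> \<alpha> ** \<beta> = mat 1
      then contour_integral (linepath z0 (moebius \<alpha> z0)) (\<lambda>z. f z * slash l g \<beta> z)
      else 0)"

definition tau0 :: "complex \<Rightarrow> crossed \<Rightarrow> crossed \<Rightarrow> complex" where
  "tau0 z0 a b = (\<Sum>(k, \<alpha>)\<in>Poly_Mapping.keys a. \<Sum>(l, \<beta>)\<in>Poly_Mapping.keys b.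
     tau0_monomial z0 k (Poly_Mapping.lookup a (k, \<alpha>)) \<alpha> l (Poly_Mapping.lookup b (l, \<beta>)) \<beta>)"

end

theory Submission
  imports Defs
begin

text \<open>
  \<^bold>\<open>Cocycle.\<close> In weight 2 the automorphy factor of \<open>\<gamma>\<close> is the derivative of \<open>z \<mapsto> \<gamma>z\<close>, so
  the slash action is the pullback of the differential form \<open>F dz\<close>
  (\<open>contour_integral_slash_2\<close>), and on the convex upper half plane the integral of \<open>F dz\<close> depends
  on the end points only. For monomials whose group elements multiply to 1 and whose weights add up
  to 2, the substitution by one of the group elements turns all terms of the two identities into
  integrals of one form \<open>F dz\<close>: over a segment and its reverse for the antisymmetry
  (\<open>tau0_monomial_cyclic\<close>), over the sides of the triangle \<open>z\<^sub>0, \<alpha>z\<^sub>0, \<alpha>\<beta>z\<^sub>0\<close> for the Hochschild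
  identity (\<open>tau0_monomial_hochschild\<close>). For all other monomials every term is 0.

  \<^bold>\<open>Invariance.\<close> The elements \<open>h\<close> for which the invariance holds form a subalgebra, since both
  the coproduct and the modular character are multiplicative, and \<open>X\<close>, \<open>Y\<close>, \<open>\<delta>\<^sub>1\<close> generate
  (\<open>invariant_all\<close>). The generator \<open>Y\<close> acts on both arguments by half the weight, and the total
  weight is 2 wherever the functional is not 0. The generators \<open>X\<close> and \<open>\<delta>\<^sub>1\<close> raise the total weight by 2, so only
  monomials \<open>f U\<^sub>\<alpha>\<close> and \<open>g U\<^sub>\<beta>\<close> with \<open>\<alpha>\<beta> = 1\<close> and opposite weights matter. Here the analysis
  enters: there are no nonzero modular forms of negative weight, and those of weight 0 are constant.
  So either one of the two monomials vanishes, or both forms are constant and the product of the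
  monomials is a multiple of the unit, which a Hopf action multiplies by the counit
  \<open>\<epsilon>(X) = \<epsilon>(\<delta>\<^sub>1) = 0\<close>. Expanding \<open>h(ab) = 0\<close> with the coproduct and integrating the coefficient
  at \<open>U\<^sub>1\<close> from \<open>z\<^sub>0\<close> to \<open>\<alpha>z\<^sub>0\<close> gives exactly the required sum (\<open>tau0_act_raising\<close>).

  \<^bold>\<open>Forms of weight at most 0.\<close> The translates of a form under \<open>SL\<^sub>2(\<int>)\<close> are finite in number
  and are bounded on every half plane \<open>Im z \<ge> b > 0\<close>. By Dirichlet approximation every orbit meets
  \<open>Im z \<ge> 1/5\<close> (\<open>SL2Z_orbit_Im_ge\<close>), which transports these bounds to the whole upper half plane.
  A Phragmen-Lindelof argument (\<open>half_plane_maximum\<close>) bounds a bounded holomorphic function on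
  \<open>Im z \<ge> b\<close> by its values on the line \<open>Im z = b\<close>. For negative weight these tend to 0 with \<open>b\<close>; for weight 0
  the line \<open>Im z = 1/5\<close> yields a point at which a translate attains its maximum.
\<close>

section \<open>Moebius transformations and the slash action\<close>

lemma mat_1_in_GL2Q_pos: "mat 1 \<in> GL2Q_pos"
  by (simp add: GL2Q_pos_def)

lemma GL2Q_pos_mult: "\<alpha> \<in> GL2Q_pos \<Longrightarrow> \<beta> \<in> GL2Q_pos \<Longrightarrow> \<alpha> ** \<beta> \<in> GL2Q_pos"
  by (simp add: GL2Q_pos_def det_mul)

lemma matrix_inv_unique:
  fixes A B :: "rat^'n^'n"
  assumes "A ** B = mat 1"
  shows "matrix_inv A = B"
proof -
  have "A ** matrix_inv A = mat 1 \<and> matrix_inv A ** A = mat 1"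
    unfolding matrix_inv_def
    by (rule someI[of _ B]) (use assms in \<open>simp add: matrix_left_right_inverse\<close>)
  then show ?thesis
    by (metis assms matrix_mul_assoc matrix_mul_lid matrix_mul_rid)
qed

lemma GL2Q_pos_inv:
  assumes "\<gamma> \<in> GL2Q_pos"
  shows "matrix_inv \<gamma> \<in> GL2Q_pos" "\<gamma> ** matrix_inv \<gamma> = mat 1" "matrix_inv \<gamma> ** \<gamma> = mat 1"
proof -
  have "invertible \<gamma>"
    using assms by (simp add: GL2Q_pos_def invertible_det_nz)
  then obtain B where "\<gamma> ** B = mat 1"
    by (auto simp: invertible_def)
  then show *: "\<gamma> ** matrix_inv \<gamma> = mat 1"
    using matrix_inv_unique by blast
  then show "matrix_inv \<gamma> ** \<gamma> = mat 1"
    by (simp add: matrix_left_right_inverse)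
  have "det \<gamma> * det (matrix_inv \<gamma>) = 1"
    using * by (metis det_I det_mul)
  then show "matrix_inv \<gamma> \<in> GL2Q_pos"
    using assms unfolding GL2Q_pos_def
    by (metis mem_Collect_eq zero_less_mult_pos zero_less_one)
qed

lemma of_real_of_rat: "of_real (of_rat q) = (of_rat q :: complex)"
  by (cases q) (simp add: of_rat_rat)

lemma Re_of_rat [simp]: "Re (of_rat q) = of_rat q"
  and Im_of_rat [simp]: "Im (of_rat q) = 0"
  by (simp_all flip: of_real_of_rat)

lemma Im_moebius_numerator:
  "Im ((of_rat a * z + of_rat b) * cnj (of_rat c * z + of_rat d)) = of_rat (a * d - b * c) * Im z"
  by (simp add: of_rat_diff of_rat_mult algebra_simps)

lemma moebius_denom_nonzero:
  assumes "\<gamma> \<in> GL2Q_pos" "z \<in> upper_half_plane"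
  shows "moebius_denom \<gamma> z \<noteq> 0"
proof
  assume "moebius_denom \<gamma> z = 0"
  then have "real_of_rat (det \<gamma>) * Im z = 0"
    using Im_moebius_numerator[of "\<gamma> $ 1 $ 1" z "\<gamma> $ 1 $ 2" "\<gamma> $ 2 $ 1" "\<gamma> $ 2 $ 2"]
    by (simp add: moebius_denom_def det_2)
  then show False using assms by (simp add: GL2Q_pos_def)
qed

lemma Im_moebius:
  "Im (moebius \<gamma> z) = of_rat (det \<gamma>) * Im z / (norm (moebius_denom \<gamma> z))\<^sup>2"
  using Im_moebius_numerator[of "\<gamma> $ 1 $ 1" z "\<gamma> $ 1 $ 2" "\<gamma> $ 2 $ 1" "\<gamma> $ 2 $ 2"]
  by (simp only: moebius_def Im_divide_Reals complex_div_cnj[of _ "moebius_denom \<gamma> z"]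
        flip: of_real_power)
     (simp add: moebius_denom_def det_2)

lemma moebius_in_uhp:
  assumes "\<gamma> \<in> GL2Q_pos" "z \<in> upper_half_plane"
  shows "moebius \<gamma> z \<in> upper_half_plane"
  using assms moebius_denom_nonzero[OF assms] by (simp add: Im_moebius GL2Q_pos_def)

lemma moebius_denom_mult:
  assumes "\<beta> \<in> GL2Q_pos" "z \<in> upper_half_plane"
  shows "moebius_denom (\<alpha> ** \<beta>) z = moebius_denom \<alpha> (moebius \<beta> z) * moebius_denom \<beta> z"
  using moebius_denom_nonzero[OF assms]
  by (simp add: moebius_def moebius_denom_def[of \<alpha>] field_simps)
     (simp add: moebius_denom_def matrix_matrix_mult_def sum_2 of_rat_add of_rat_mult algebra_simps)

lemma moebius_mult:
  assumes "\<alpha> \<in> GL2Q_pos" "\<beta> \<in> GL2Q_pos" "z \<in> upper_half_plane"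
  shows "moebius (\<alpha> ** \<beta>) z = moebius \<alpha> (moebius \<beta> z)"
proof -
  have nz: "moebius_denom \<beta> z \<noteq> 0" "moebius_denom \<alpha> (moebius \<beta> z) \<noteq> 0"
    using moebius_denom_nonzero assms moebius_in_uhp by blast+
  have "(of_rat ((\<alpha> ** \<beta>) $ 1 $ 1) * z + of_rat ((\<alpha> ** \<beta>) $ 1 $ 2) :: complex) =
      (of_rat (\<alpha> $ 1 $ 1) * moebius \<beta> z + of_rat (\<alpha> $ 1 $ 2)) * moebius_denom \<beta> z"
    using nz(1)
    by (simp add: moebius_def field_simps)
       (simp add: moebius_denom_def matrix_matrix_mult_def sum_2 of_rat_add of_rat_mult algebra_simps)
  then show ?thesis
    using nz assms by (simp add: moebius_def[of "\<alpha> ** \<beta>"] moebius_def[of \<alpha>] moebius_denom_mult)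
qed

lemma moebius_mat_1: "moebius (mat 1) z = z"
  by (simp add: moebius_def moebius_denom_def mat_def)

lemma moebius_inverse:
  assumes "\<alpha> \<in> GL2Q_pos" "\<beta> \<in> GL2Q_pos" "\<alpha> ** \<beta> = mat 1" "z \<in> upper_half_plane"
  shows "moebius \<alpha> (moebius \<beta> z) = z"
  using assms moebius_mult[of \<alpha> \<beta> z] by (simp add: moebius_mat_1)

lemma moebius_has_field_derivative:
  assumes "\<gamma> \<in> GL2Q_pos" "z \<in> upper_half_plane"
  shows "(moebius \<gamma> has_field_derivative of_rat (det \<gamma>) / (moebius_denom \<gamma> z)\<^sup>2) (at z)"
  using moebius_denom_nonzero[OF assms]
  unfolding moebius_def[abs_def] moebius_denom_def
  by (auto intro!: derivative_eq_intros simp: det_2 of_rat_diff of_rat_mult power2_eq_square field_simps)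

definition automorphy_factor :: "int \<Rightarrow> rat^2^2 \<Rightarrow> complex \<Rightarrow> complex" where
  "automorphy_factor k \<gamma> z =
     of_real (real_of_rat (det \<gamma>) powr (of_int k / 2)) * moebius_denom \<gamma> z powi (- k)"

lemma slash_eq:
  "z \<in> upper_half_plane \<Longrightarrow> slash k f \<gamma> z = automorphy_factor k \<gamma> z * f (moebius \<gamma> z)"
  by (simp add: slash_def on_uhp_def automorphy_factor_def)

lemma slash_outside: "z \<notin> upper_half_plane \<Longrightarrow> slash k f \<gamma> z = 0"
  by (simp add: slash_def on_uhp_def)

lemma automorphy_factor_add:
  assumes "\<gamma> \<in> GL2Q_pos" "z \<in> upper_half_plane"
  shows "automorphy_factor (k + l) \<gamma> z = automorphy_factor k \<gamma> z * automorphy_factor l \<gamma> z"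
proof -
  have "moebius_denom \<gamma> z powi (- (k + l)) = moebius_denom \<gamma> z powi (- k) * moebius_denom \<gamma> z powi (- l)"
    using power_int_add[of "moebius_denom \<gamma> z" "- k" "- l"] moebius_denom_nonzero[OF assms] by simp
  then show ?thesis
    by (simp add: automorphy_factor_def add_divide_distrib powr_add)
qed

lemma automorphy_factor_0:
  assumes "\<gamma> \<in> GL2Q_pos"
  shows "automorphy_factor 0 \<gamma> z = 1"
  using assms by (simp add: automorphy_factor_def GL2Q_pos_def)

lemma automorphy_factor_2:
  assumes "\<gamma> \<in> GL2Q_pos"
  shows "automorphy_factor 2 \<gamma> z = of_rat (det \<gamma>) / (moebius_denom \<gamma> z)\<^sup>2"
  using assms
  by (simp add: automorphy_factor_def GL2Q_pos_def power_int_minus divide_inverse of_real_of_rat)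

lemma automorphy_factor_mult:
  assumes "\<alpha> \<in> GL2Q_pos" "\<beta> \<in> GL2Q_pos" "z \<in> upper_half_plane"
  shows "automorphy_factor k (\<alpha> ** \<beta>) z
    = automorphy_factor k \<alpha> (moebius \<beta> z) * automorphy_factor k \<beta> z"
  using assms
  by (simp add: automorphy_factor_def moebius_denom_mult power_int_mult_distrib det_mul of_rat_mult
        powr_mult GL2Q_pos_def)

lemma slash_slash:
  assumes "\<alpha> \<in> GL2Q_pos" "\<beta> \<in> GL2Q_pos"
  shows "slash k (slash k f \<alpha>) \<beta> = slash k f (\<alpha> ** \<beta>)"
proof
  fix z
  show "slash k (slash k f \<alpha>) \<beta> z = slash k f (\<alpha> ** \<beta>) z"
  proof (cases "z \<in> upper_half_plane")
    case True
    then show ?thesis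
      using assms moebius_in_uhp[of \<beta> z]
      by (simp add: slash_eq automorphy_factor_mult moebius_mult)
  qed (simp add: slash_outside)
qed

lemma slash_mult:
  assumes "\<gamma> \<in> GL2Q_pos"
  shows "slash (k + l) (\<lambda>z. f z * g z) \<gamma> = (\<lambda>z. slash k f \<gamma> z * slash l g \<gamma> z)"
proof
  fix z
  show "slash (k + l) (\<lambda>z. f z * g z) \<gamma> z = slash k f \<gamma> z * slash l g \<gamma> z"
    by (cases "z \<in> upper_half_plane") (simp_all add: slash_eq slash_outside automorphy_factor_add assms)
qed

lemma slash_add: "slash k (\<lambda>z. f z + g z) \<gamma> = (\<lambda>z. slash k f \<gamma> z + slash k g \<gamma> z)"
  by (auto simp: fun_eq_iff slash_def on_uhp_def algebra_simps)

lemma slash_scale: "slash k (\<lambda>z. c * f z) \<gamma> = (\<lambda>z. c * slash k f \<gamma> z)"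
  by (auto simp: fun_eq_iff slash_def on_uhp_def algebra_simps)

lemma slash_zero: "slash k 0 \<gamma> = 0"
  by (auto simp: fun_eq_iff slash_def on_uhp_def)

text \<open>
  Vanishing off the half plane, as for \<^const>\<open>on_uhp\<close>, turns equality on the half plane into
  equality of functions; \<open>slash_mat_1\<close> depends on it.
\<close>

definition uhp_holomorphic :: "(complex \<Rightarrow> complex) set" where
  "uhp_holomorphic = {f. f holomorphic_on upper_half_plane \<and> (\<forall>z. z \<notin> upper_half_plane \<longrightarrow> f z = 0)}"

lemma uhp_holomorphicD:
  assumes "f \<in> uhp_holomorphic"
  shows "f holomorphic_on upper_half_plane" "z \<notin> upper_half_plane \<Longrightarrow> f z = 0"
  using assms by (auto simp: uhp_holomorphic_def)

lemma uhp_holomorphic_zero: "0 \<in> uhp_holomorphic"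
  by (simp add: uhp_holomorphic_def zero_fun_def)

lemma uhp_holomorphic_add: "f \<in> uhp_holomorphic \<Longrightarrow> g \<in> uhp_holomorphic \<Longrightarrow> f + g \<in> uhp_holomorphic"
  by (auto simp: uhp_holomorphic_def plus_fun_def intro: holomorphic_on_add)

lemma uhp_holomorphic_mult:
  "f \<in> uhp_holomorphic \<Longrightarrow> g \<in> uhp_holomorphic \<Longrightarrow> (\<lambda>z. f z * g z) \<in> uhp_holomorphic"
  by (auto simp: uhp_holomorphic_def intro: holomorphic_on_mult)

lemma modular_forms_uhp_holomorphic: "modular_forms k \<subseteq> uhp_holomorphic"
  by (auto simp: modular_forms_def modular_forms_level_def uhp_holomorphic_def)

lemma slash_mat_1:
  assumes "f \<in> uhp_holomorphic"
  shows "slash k f (mat 1) = f"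
proof
  fix z
  show "slash k f (mat 1) z = f z"
    using uhp_holomorphicD(2)[OF assms, of z]
    by (cases "z \<in> upper_half_plane")
       (simp_all add: slash_def on_uhp_def moebius_mat_1, simp add: moebius_denom_def mat_def)
qed

lemma slash_uhp_holomorphic:
  assumes "f \<in> uhp_holomorphic" "\<gamma> \<in> GL2Q_pos"
  shows "slash k f \<gamma> \<in> uhp_holomorphic"
proof -
  have "moebius_denom \<gamma> holomorphic_on upper_half_plane"
    unfolding moebius_denom_def[abs_def] by (intro holomorphic_intros)
  then have "automorphy_factor k \<gamma> holomorphic_on upper_half_plane"
    unfolding automorphy_factor_def[abs_def]
    using moebius_denom_nonzero[OF assms(2)] by (intro holomorphic_intros) auto
  moreover have "(f \<circ> moebius \<gamma>) holomorphic_on upper_half_plane"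
  proof (rule holomorphic_on_compose_gen)
    show "moebius \<gamma> holomorphic_on upper_half_plane"
      using moebius_has_field_derivative[OF assms(2)]
      by (auto simp: holomorphic_on_def field_differentiable_def intro: has_field_derivative_at_within)
    show "f holomorphic_on upper_half_plane" using assms(1) by (rule uhp_holomorphicD)
    show "moebius \<gamma> ` upper_half_plane \<subseteq> upper_half_plane"
      using moebius_in_uhp[OF assms(2)] by blast
  qed
  ultimately have "(\<lambda>z. automorphy_factor k \<gamma> z * (f \<circ> moebius \<gamma>) z) holomorphic_on upper_half_plane"
    by (rule holomorphic_on_mult)
  then have "slash k f \<gamma> holomorphic_on upper_half_plane"
    by (rule holomorphic_transform) (simp add: slash_eq)
  then show ?thesis
    by (simp add: uhp_holomorphic_def slash_outside)
qed

section \<open>Integrals of holomorphic functions over segments\<close>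

lemma convex_uhp: "convex upper_half_plane"
  using convex_halfspace_Im_gt[of 0] by simp

lemma open_uhp: "open upper_half_plane"
  using open_halfspace_Im_gt[of 0] by simp

text \<open>
  All properties of the integrals below come from the existence of a global primitive on the
  convex upper half plane.
\<close>

lemma uhp_primitive:
  assumes "F \<in> uhp_holomorphic"
  obtains G where
    "\<And>z. z \<in> upper_half_plane \<Longrightarrow> (G has_field_derivative F z) (at z)"
    "\<And>a b. a \<in> upper_half_plane \<Longrightarrow> b \<in> upper_half_plane \<Longrightarrow>
       (F has_contour_integral G b - G a) (linepath a b)"
proof -
  obtain G where G: "\<And>z. z \<in> upper_half_plane \<Longrightarrow> (G has_field_derivative F z) (at z within upper_half_plane)"
    using holomorphic_convex_primitive'[OF convex_uhp open_uhp uhp_holomorphicD(1)[OF assms]] by blast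
  show thesis
  proof
    show "(G has_field_derivative F z) (at z)" if "z \<in> upper_half_plane" for z
      using G[OF that] that open_uhp by (metis at_within_open)
    show "(F has_contour_integral G b - G a) (linepath a b)"
      if "a \<in> upper_half_plane" "b \<in> upper_half_plane" for a b
      using contour_integral_primitive[OF G, of "linepath a b"] that
        closed_segment_subset[OF _ _ convex_uhp, of a b] by auto
  qed
qed

lemma uhp_contour_integral_add:
  assumes "F \<in> uhp_holomorphic" "G \<in> uhp_holomorphic" "a \<in> upper_half_plane" "b \<in> upper_half_plane"
  shows "contour_integral (linepath a b) (\<lambda>z. F z + G z)
    = contour_integral (linepath a b) F + contour_integral (linepath a b) G"
proof -
  have "H contour_integrable_on linepath a b" if "H \<in> uhp_holomorphic" for H
    using uhp_primitive[OF that] assms(3,4) by (metis contour_integrable_on_def)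
  then show ?thesis using assms by (intro contour_integral_add)
qed

lemma uhp_contour_integral_split:
  assumes "F \<in> uhp_holomorphic"
    and "a \<in> upper_half_plane" "b \<in> upper_half_plane" "c \<in> upper_half_plane"
  shows "contour_integral (linepath a b) F + contour_integral (linepath b c) F
    = contour_integral (linepath a c) F"
proof -
  obtain G where G: "\<And>a b. a \<in> upper_half_plane \<Longrightarrow> b \<in> upper_half_plane \<Longrightarrow>
       (F has_contour_integral G b - G a) (linepath a b)"
    using uhp_primitive[OF assms(1)] by metis
  show ?thesis
    using assms(2-4) by (simp add: contour_integral_unique[OF G] del: mem_Collect_eq)
qed

lemma uhp_contour_integral_reverse:
  assumes "F \<in> uhp_holomorphic" "a \<in> upper_half_plane" "b \<in> upper_half_plane"
  shows "contour_integral (linepath b a) F = - contour_integral (linepath a b) F"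
  using uhp_contour_integral_split[OF assms assms(2)]
  by (simp add: add_eq_0_iff2 add.commute)

text \<open>
  In weight 2 the automorphy factor is the derivative of the transformation, so the slash action
  is the pullback of the differential \<open>F dz\<close>.
\<close>

lemma contour_integral_slash_2:
  assumes F: "F \<in> uhp_holomorphic" and \<gamma>: "\<gamma> \<in> GL2Q_pos"
    and ab: "a \<in> upper_half_plane" "b \<in> upper_half_plane"
  shows "contour_integral (linepath a b) (slash 2 F \<gamma>)
    = contour_integral (linepath (moebius \<gamma> a) (moebius \<gamma> b)) F"
proof -
  obtain G where G: "\<And>z. z \<in> upper_half_plane \<Longrightarrow> (G has_field_derivative F z) (at z)"
    "\<And>a b. a \<in> upper_half_plane \<Longrightarrow> b \<in> upper_half_plane \<Longrightarrow>
       (F has_contour_integral G b - G a) (linepath a b)"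
    using uhp_primitive[OF F] by metis
  have "((G \<circ> moebius \<gamma>) has_field_derivative slash 2 F \<gamma> z) (at z)" if "z \<in> upper_half_plane" for z
    using DERIV_chain[OF G(1)[OF moebius_in_uhp[OF \<gamma> that]] moebius_has_field_derivative[OF \<gamma> that]]
    by (simp only: slash_eq[OF that] automorphy_factor_2[OF \<gamma>] mult.commute)
  then have "((slash 2 F \<gamma>) has_contour_integral (G \<circ> moebius \<gamma>) b - (G \<circ> moebius \<gamma>) a) (linepath a b)"
    using contour_integral_primitive[of upper_half_plane "G \<circ> moebius \<gamma>" "slash 2 F \<gamma>" "linepath a b"]
      ab closed_segment_subset[OF ab convex_uhp] by (auto intro: has_field_derivative_at_within)
  then show ?thesis
    using contour_integral_unique[OF G(2)[OF moebius_in_uhp[OF \<gamma> ab(1)] moebius_in_uhp[OF \<gamma> ab(2)]]]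
    by (simp add: contour_integral_unique)
qed

section \<open>Finite sums of monomials\<close>

lemma sum_keys_superset:
  fixes \<Phi> :: "'x \<Rightarrow> 'b::zero \<Rightarrow> 'c::comm_monoid_add"
  assumes "finite K" "Poly_Mapping.keys a \<subseteq> K" "\<And>x. \<Phi> x 0 = 0"
  shows "(\<Sum>x\<in>Poly_Mapping.keys a. \<Phi> x (Poly_Mapping.lookup a x))
    = (\<Sum>x\<in>K. \<Phi> x (Poly_Mapping.lookup a x))"
  by (rule sum.mono_neutral_left) (use assms in \<open>auto simp: in_keys_iff\<close>)

lemma sum_keys_add:
  fixes \<Phi> :: "'x \<Rightarrow> 'b::comm_monoid_add \<Rightarrow> 'c::comm_monoid_add"
  assumes "\<And>x. \<Phi> x 0 = 0"
    and "\<And>x. x \<in> Poly_Mapping.keys a \<union> Poly_Mapping.keys b \<Longrightarrow>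
      \<Phi> x (Poly_Mapping.lookup a x + Poly_Mapping.lookup b x)
        = \<Phi> x (Poly_Mapping.lookup a x) + \<Phi> x (Poly_Mapping.lookup b x)"
  shows "(\<Sum>x\<in>Poly_Mapping.keys (a + b). \<Phi> x (Poly_Mapping.lookup (a + b) x))
    = (\<Sum>x\<in>Poly_Mapping.keys a. \<Phi> x (Poly_Mapping.lookup a x))
      + (\<Sum>x\<in>Poly_Mapping.keys b. \<Phi> x (Poly_Mapping.lookup b x))"
proof -
  let ?K = "Poly_Mapping.keys a \<union> Poly_Mapping.keys b"
  have K: "(\<Sum>x\<in>Poly_Mapping.keys c. \<Phi> x (Poly_Mapping.lookup c x))
      = (\<Sum>x\<in>?K. \<Phi> x (Poly_Mapping.lookup c x))" if "Poly_Mapping.keys c \<subseteq> ?K" for c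
    by (rule sum_keys_superset) (use that assms(1) in auto)
  have "(\<Sum>x\<in>?K. \<Phi> x (Poly_Mapping.lookup (a + b) x))
      = (\<Sum>x\<in>?K. \<Phi> x (Poly_Mapping.lookup a x) + \<Phi> x (Poly_Mapping.lookup b x))"
    by (rule sum.cong) (use assms(2) in \<open>simp_all add: lookup_add\<close>)
  then show ?thesis
    using K[OF keys_add] K[of a] K[of b] by (simp add: sum.distrib)
qed

text \<open>
  The coefficients are a parameter because two choices occur: modular forms for the Hopf action, and
  holomorphic functions for the cocycle identities, a class that is obviously closed under the slash
  action of all of \<^const>\<open>GL2Q_pos\<close> and hence under the product.
\<close>

definition crossed_over :: "(int \<Rightarrow> (complex \<Rightarrow> complex) set) \<Rightarrow> crossed set" where
  "crossed_over M = {a. \<forall>k \<gamma>. (k, \<gamma>) \<in> Poly_Mapping.keys a \<longrightarrow>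
     \<gamma> \<in> GL2Q_pos \<and> Poly_Mapping.lookup a (k, \<gamma>) \<in> M k}"

abbreviation holomorphic_crossed :: "crossed set" where
  "holomorphic_crossed \<equiv> crossed_over (\<lambda>_. uhp_holomorphic)"

lemma crossed_product_eq: "crossed_product = crossed_over modular_forms"
  by (simp add: crossed_product_def crossed_over_def)

lemma crossed_product_subset: "crossed_product \<subseteq> holomorphic_crossed"
  using modular_forms_uhp_holomorphic by (fastforce simp: crossed_product_def crossed_over_def)

lemma monomial_in_crossed_over:
  "f \<in> M k \<Longrightarrow> \<gamma> \<in> GL2Q_pos \<Longrightarrow> monomial k f \<gamma> \<in> crossed_over M"
  by (auto simp: crossed_over_def monomial_def)

lemma zero_in_crossed_over: "0 \<in> crossed_over M"
  by (simp add: crossed_over_def)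

lemma holomorphic_crossed_lookup:
  "a \<in> holomorphic_crossed \<Longrightarrow> Poly_Mapping.lookup a x \<in> uhp_holomorphic"
  by (cases x; cases "x \<in> Poly_Mapping.keys a")
     (auto simp: crossed_over_def in_keys_iff uhp_holomorphic_zero)

lemma crossed_over_keys:
  "a \<in> crossed_over M \<Longrightarrow> (k, \<gamma>) \<in> Poly_Mapping.keys a \<Longrightarrow> \<gamma> \<in> GL2Q_pos"
  by (auto simp: crossed_over_def)

lemma holomorphic_crossed_add:
  assumes "a \<in> holomorphic_crossed" "b \<in> holomorphic_crossed"
  shows "a + b \<in> holomorphic_crossed"
  using assms keys_add[of a b] holomorphic_crossed_lookup[OF assms(1)]
    holomorphic_crossed_lookup[OF assms(2)]
  by (auto simp: crossed_over_def lookup_add intro!: uhp_holomorphic_add)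

text \<open>
  The induction adds up distinct entries of the given element, so that the partial sums stay in
  \<^term>\<open>crossed_over M\<close> for an arbitrary family \<open>M\<close>.
\<close>

lemma crossed_over_induct [consumes 1, case_names zero monomial add]:
  assumes a: "a \<in> crossed_over M"
    and zero: "P 0"
    and monomial: "\<And>k f \<gamma>. f \<in> M k \<Longrightarrow> \<gamma> \<in> GL2Q_pos \<Longrightarrow> P (monomial k f \<gamma>)"
    and add: "\<And>p q. p \<in> crossed_over M \<Longrightarrow> q \<in> crossed_over M \<Longrightarrow> P p \<Longrightarrow> P q \<Longrightarrow> P (p + q)"
  shows "P a"
proof -
  define part where "part K = (\<Sum>x\<in>K. Poly_Mapping.single x (Poly_Mapping.lookup a x))" for K
  have lookup: "Poly_Mapping.lookup (part K) x = (if x \<in> K then Poly_Mapping.lookup a x else 0)"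
    if "finite K" for K x
    using that by (simp add: part_def lookup_sum lookup_single when_def sum.delta)
  have part_in: "part K \<in> crossed_over M" if "finite K" for K
    using a lookup[OF that] by (auto simp: crossed_over_def in_keys_iff)
  have "P (part K)" if "finite K" "K \<subseteq> Poly_Mapping.keys a" for K
    using that
  proof (induction K)
    case empty
    then show ?case using zero by (simp add: part_def)
  next
    case (insert x K)
    obtain k \<gamma> where x: "x = (k, \<gamma>)" by (cases x)
    have c: "Poly_Mapping.lookup a x \<in> M k" "\<gamma> \<in> GL2Q_pos"
      using a insert.prems x by (auto simp: crossed_over_def)
    have "part (insert x K) = monomial k (Poly_Mapping.lookup a x) \<gamma> + part K"
      using insert by (simp add: part_def monomial_def x)
    then show ?case
      using insert part_in by (simp add: add monomial monomial_in_crossed_over c)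
  qed
  moreover have "part (Poly_Mapping.keys a) = a"
    unfolding part_def by (rule poly_mapping_sum_singles[symmetric])
  ultimately show ?thesis by (metis finite_keys order_refl)
qed

lemma lookup_crossed_scale: "Poly_Mapping.lookup (crossed_scale c a) x = (\<lambda>z. c * Poly_Mapping.lookup a x z)"
  by (auto simp: crossed_scale_def Poly_Mapping.map.rep_eq when_def fun_eq_iff)

lemma keys_crossed_scale: "Poly_Mapping.keys (crossed_scale c a) \<subseteq> Poly_Mapping.keys a"
  by (auto simp: in_keys_iff lookup_crossed_scale fun_eq_iff)

lemma crossed_scale_monomial: "crossed_scale c (monomial k f \<gamma>) = monomial k (\<lambda>z. c * f z) \<gamma>"
  by (rule poly_mapping_eqI)
     (auto simp: lookup_crossed_scale monomial_def lookup_single when_def)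

section \<open>The product of the crossed product\<close>

lemma crossed_mult_monomial:
  "monomial k f \<alpha> \<odot> monomial l g \<beta> = monomial (k + l) (\<lambda>z. f z * slash l g (matrix_inv \<alpha>) z) (\<alpha> ** \<beta>)"
proof (cases "f = 0 \<or> g = 0")
  case True
  then have "monomial k f \<alpha> \<odot> monomial l g \<beta> = 0"
    by (auto simp: crossed_mult_def monomial_def)
  moreover have "(\<lambda>z. f z * slash l g (matrix_inv \<alpha>) z) = 0"
    using True slash_zero[of l "matrix_inv \<alpha>"] by (auto simp: zero_fun_def)
  ultimately show ?thesis by (simp add: monomial_def)
next
  case False
  then show ?thesis by (simp add: crossed_mult_def monomial_def)
qed

lemma monomial_add: "monomial k (\<lambda>z. f z + g z) \<gamma> = monomial k f \<gamma> + monomial k g \<gamma>"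
  unfolding monomial_def using single_add[of "(k, \<gamma>)" f g] by (simp only: plus_fun_def[of f g])

lemma monomial_zero: "monomial k (\<lambda>z. 0) \<gamma> = 0"
  using single_zero[of "(k, \<gamma>)", where ?'b = "complex \<Rightarrow> complex"]
  by (simp only: monomial_def zero_fun_def)

lemma crossed_mult_add_left: "(a + a') \<odot> b = a \<odot> b + a' \<odot> b"
proof -
  define \<Phi> where "\<Phi> x f = (\<Sum>y\<in>Poly_Mapping.keys b. monomial (fst x + fst y)
       (\<lambda>z. f z * slash (fst y) (Poly_Mapping.lookup b y) (matrix_inv (snd x)) z) (snd x ** snd y))"
    for x f
  have mult: "c \<odot> b = (\<Sum>x\<in>Poly_Mapping.keys c. \<Phi> x (Poly_Mapping.lookup c x))" for c
    by (simp add: crossed_mult_def split_def \<Phi>_def)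
  show ?thesis
    unfolding mult
    by (rule sum_keys_add[of \<Phi>])
       (simp_all add: \<Phi>_def plus_fun_def distrib_right monomial_add monomial_zero sum.distrib)
qed

lemma crossed_mult_add_right: "a \<odot> (b + b') = a \<odot> b + a \<odot> b'"
proof -
  define \<Phi> where "\<Phi> x y g = monomial (fst x + fst y)
       (\<lambda>z. Poly_Mapping.lookup a x z * slash (fst y) g (matrix_inv (snd x)) z) (snd x ** snd y)"
    for x y g
  have mult: "a \<odot> c = (\<Sum>x\<in>Poly_Mapping.keys a. \<Sum>y\<in>Poly_Mapping.keys c. \<Phi> x y (Poly_Mapping.lookup c y))"
    for c
    by (simp add: crossed_mult_def split_def \<Phi>_def)
  have "\<Phi> x y 0 = 0" "\<Phi> x y (g + h) = \<Phi> x y g + \<Phi> x y h" for x y g h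
    by (simp_all add: \<Phi>_def slash_zero monomial_zero plus_fun_def slash_add distrib_left monomial_add)
  then have "(\<Sum>y\<in>Poly_Mapping.keys (b + b'). \<Phi> x y (Poly_Mapping.lookup (b + b') y))
      = (\<Sum>y\<in>Poly_Mapping.keys b. \<Phi> x y (Poly_Mapping.lookup b y))
        + (\<Sum>y\<in>Poly_Mapping.keys b'. \<Phi> x y (Poly_Mapping.lookup b' y))" for x
    by (intro sum_keys_add[of "\<Phi> x"]) simp_all
  then show ?thesis
    unfolding mult by (simp add: sum.distrib)
qed

lemma crossed_mult_zero: "0 \<odot> b = 0" "a \<odot> 0 = 0"
  by (simp_all add: crossed_mult_def)

lemma monomial_mult_in_holomorphic_crossed:
  assumes "f \<in> uhp_holomorphic" "\<alpha> \<in> GL2Q_pos" "g \<in> uhp_holomorphic" "\<beta> \<in> GL2Q_pos"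
  shows "monomial k f \<alpha> \<odot> monomial l g \<beta> \<in> holomorphic_crossed"
  unfolding crossed_mult_monomial
  by (intro monomial_in_crossed_over uhp_holomorphic_mult slash_uhp_holomorphic GL2Q_pos_mult
      GL2Q_pos_inv(1) assms)

lemma holomorphic_crossed_mult:
  assumes "a \<in> holomorphic_crossed" "b \<in> holomorphic_crossed"
  shows "a \<odot> b \<in> holomorphic_crossed"
  using assms(1)
proof (induction a rule: crossed_over_induct)
  case (monomial k f \<alpha>)
  from assms(2) show ?case
    by (induction b rule: crossed_over_induct)
       (simp_all add: crossed_mult_add_right holomorphic_crossed_add crossed_mult_zero
          zero_in_crossed_over monomial monomial_mult_in_holomorphic_crossed)
qed (simp_all add: crossed_mult_add_left holomorphic_crossed_add crossed_mult_zero zero_in_crossed_over)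

section \<open>The functional is a cyclic cocycle\<close>

context
  fixes z0 :: complex
  assumes z0: "z0 \<in> upper_half_plane"
begin

lemma tau0_monomial_eq_tau0:
  "tau0 z0 (monomial k f \<alpha>) (monomial l g \<beta>) = tau0_monomial z0 k f \<alpha> l g \<beta>"
proof (cases "f = 0 \<or> g = 0")
  case True
  then have "tau0 z0 (monomial k f \<alpha>) (monomial l g \<beta>) = 0"
    by (auto simp: tau0_def monomial_def)
  moreover have "(\<lambda>z. f z * slash l g \<beta> z) = (\<lambda>z. 0)"
    using True by (auto simp: slash_zero)
  ultimately show ?thesis by (simp add: tau0_monomial_def)
next
  case False
  then show ?thesis by (simp add: tau0_def monomial_def)
qed

lemma tau0_monomial_zero:
  "tau0_monomial z0 k 0 \<alpha> l g \<beta> = 0" "tau0_monomial z0 k f \<alpha> l 0 \<beta> = 0"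
  by (simp_all add: tau0_monomial_def slash_zero)

lemma tau0_monomial_add:
  assumes "f \<in> uhp_holomorphic" "f' \<in> uhp_holomorphic" "\<alpha> \<in> GL2Q_pos"
    and "g \<in> uhp_holomorphic" "g' \<in> uhp_holomorphic" "\<beta> \<in> GL2Q_pos"
  shows "tau0_monomial z0 k (f + f') \<alpha> l g \<beta>
      = tau0_monomial z0 k f \<alpha> l g \<beta> + tau0_monomial z0 k f' \<alpha> l g \<beta>"
    and "tau0_monomial z0 k f \<alpha> l (g + g') \<beta>
      = tau0_monomial z0 k f \<alpha> l g \<beta> + tau0_monomial z0 k f \<alpha> l g' \<beta>"
  using assms z0 moebius_in_uhp[of \<alpha> z0]
  by (simp_all add: tau0_monomial_def plus_fun_def slash_add distrib_left distrib_right
      uhp_contour_integral_add uhp_holomorphic_mult slash_uhp_holomorphic del: mem_Collect_eq)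

lemma tau0_monomial_scale:
  assumes "f \<in> uhp_holomorphic" "\<alpha> \<in> GL2Q_pos" "g \<in> uhp_holomorphic" "\<beta> \<in> GL2Q_pos"
  shows "tau0_monomial z0 k (\<lambda>z. c * f z) \<alpha> l g \<beta> = c * tau0_monomial z0 k f \<alpha> l g \<beta>"
    and "tau0_monomial z0 k f \<alpha> l (\<lambda>z. c * g z) \<beta> = c * tau0_monomial z0 k f \<alpha> l g \<beta>"
proof -
  let ?F = "\<lambda>z. f z * slash l g \<beta> z"
  have F: "?F \<in> uhp_holomorphic"
    by (intro uhp_holomorphic_mult slash_uhp_holomorphic assms)
  have "?F contour_integrable_on linepath z0 (moebius \<alpha> z0)"
    using uhp_primitive[OF F] z0 moebius_in_uhp[OF assms(2) z0]
    by (metis contour_integrable_on_def)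
  then have "contour_integral (linepath z0 (moebius \<alpha> z0)) (\<lambda>z. c * ?F z)
      = c * contour_integral (linepath z0 (moebius \<alpha> z0)) ?F"
    by (rule contour_integral_lmul)
  then show "tau0_monomial z0 k (\<lambda>z. c * f z) \<alpha> l g \<beta> = c * tau0_monomial z0 k f \<alpha> l g \<beta>"
    and "tau0_monomial z0 k f \<alpha> l (\<lambda>z. c * g z) \<beta> = c * tau0_monomial z0 k f \<alpha> l g \<beta>"
    by (simp_all add: tau0_monomial_def slash_scale mult.assoc mult.left_commute[of _ c])
qed

lemma tau0_add_left:
  assumes "a \<in> holomorphic_crossed" "a' \<in> holomorphic_crossed" "b \<in> holomorphic_crossed"
  shows "tau0 z0 (a + a') b = tau0 z0 a b + tau0 z0 a' b"
proof -
  define \<Phi> where "\<Phi> x f = (\<Sum>y\<in>Poly_Mapping.keys b.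
      tau0_monomial z0 (fst x) f (snd x) (fst y) (Poly_Mapping.lookup b y) (snd y))" for x f
  have tau0: "tau0 z0 c b = (\<Sum>x\<in>Poly_Mapping.keys c. \<Phi> x (Poly_Mapping.lookup c x))" for c
    by (simp add: tau0_def split_def \<Phi>_def)
  show ?thesis
    unfolding tau0
    by (rule sum_keys_add[of \<Phi>])
       (use assms in \<open>auto simp: \<Phi>_def tau0_monomial_zero simp flip: sum.distrib
          intro!: sum.cong tau0_monomial_add(1)
          intro: holomorphic_crossed_lookup crossed_over_keys\<close>)
qed

lemma tau0_add_right:
  assumes "a \<in> holomorphic_crossed" "b \<in> holomorphic_crossed" "b' \<in> holomorphic_crossed"
  shows "tau0 z0 a (b + b') = tau0 z0 a b + tau0 z0 a b'"
proof -
  define \<Phi> where "\<Phi> y g = (\<Sum>x\<in>Poly_Mapping.keys a.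
      tau0_monomial z0 (fst x) (Poly_Mapping.lookup a x) (snd x) (fst y) g (snd y))" for y g
  have tau0: "tau0 z0 a c = (\<Sum>y\<in>Poly_Mapping.keys c. \<Phi> y (Poly_Mapping.lookup c y))" for c
    by (simp add: tau0_def split_def \<Phi>_def sum.swap[of _ "Poly_Mapping.keys a"])
  show ?thesis
    unfolding tau0
    by (rule sum_keys_add[of \<Phi>])
       (use assms in \<open>auto simp: \<Phi>_def tau0_monomial_zero simp flip: sum.distrib
          intro!: sum.cong tau0_monomial_add(2)
          intro: holomorphic_crossed_lookup crossed_over_keys\<close>)
qed

lemma tau0_zero: "tau0 z0 0 b = 0" "tau0 z0 a 0 = 0"
  by (simp_all add: tau0_def)

lemma tau0_scale:
  assumes "a \<in> holomorphic_crossed" "b \<in> holomorphic_crossed"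
  shows "tau0 z0 (crossed_scale c a) b = c * tau0 z0 a b"
    and "tau0 z0 a (crossed_scale c b) = c * tau0 z0 a b"
proof -
  define T where "T x f y g = tau0_monomial z0 (fst x) f (snd x) (fst y) g (snd y)" for x f y g
  have T0: "T x 0 y g = 0" "T x f y 0 = 0" for x f y g
    by (simp_all add: T_def tau0_monomial_zero)
  have tau0: "tau0 z0 a b = (\<Sum>x\<in>Poly_Mapping.keys a. \<Sum>y\<in>Poly_Mapping.keys b.
      T x (Poly_Mapping.lookup a x) y (Poly_Mapping.lookup b y))" for a b
    by (simp add: tau0_def split_def T_def)
  have "tau0 z0 (crossed_scale c a) b = (\<Sum>x\<in>Poly_Mapping.keys a. \<Sum>y\<in>Poly_Mapping.keys b.
      T x (Poly_Mapping.lookup (crossed_scale c a) x) y (Poly_Mapping.lookup b y))"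
    unfolding tau0
    by (rule sum_keys_superset[of _ _ "\<lambda>x f. \<Sum>y\<in>Poly_Mapping.keys b. T x f y (Poly_Mapping.lookup b y)"])
       (simp_all add: keys_crossed_scale T0)
  then show "tau0 z0 (crossed_scale c a) b = c * tau0 z0 a b"
    using assms
    by (auto simp: tau0 sum_distrib_left T_def lookup_crossed_scale tau0_monomial_scale
        holomorphic_crossed_lookup crossed_over_keys intro!: sum.cong)
  have "(\<Sum>y\<in>Poly_Mapping.keys (crossed_scale c b). T x f y (Poly_Mapping.lookup (crossed_scale c b) y))
      = (\<Sum>y\<in>Poly_Mapping.keys b. T x f y (Poly_Mapping.lookup (crossed_scale c b) y))" for x f
    by (rule sum_keys_superset[of _ _ "T x f"]) (simp_all add: keys_crossed_scale T0)
  then have "tau0 z0 a (crossed_scale c b) = (\<Sum>x\<in>Poly_Mapping.keys a. \<Sum>y\<in>Poly_Mapping.keys b.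
      T x (Poly_Mapping.lookup a x) y (Poly_Mapping.lookup (crossed_scale c b) y))"
    unfolding tau0 by simp
  then show "tau0 z0 a (crossed_scale c b) = c * tau0 z0 a b"
    using assms
    by (auto simp: tau0 sum_distrib_left T_def lookup_crossed_scale tau0_monomial_scale
        holomorphic_crossed_lookup crossed_over_keys intro!: sum.cong)
qed

text \<open>
  The substitution by \<open>\<alpha>\<close> turns the second integral into that of the first form over the reversed
  segment, from \<open>\<alpha>z\<^sub>0\<close> to \<open>\<alpha>\<beta>z\<^sub>0 = z\<^sub>0\<close>.
\<close>

lemma tau0_monomial_cyclic:
  assumes f: "f \<in> uhp_holomorphic" and \<alpha>: "\<alpha> \<in> GL2Q_pos"
    and g: "g \<in> uhp_holomorphic" and \<beta>: "\<beta> \<in> GL2Q_pos"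
  shows "tau0_monomial z0 k f \<alpha> l g \<beta> = - tau0_monomial z0 l g \<beta> k f \<alpha>"
proof (cases "k + l = 2 \<and> \<alpha> ** \<beta> = mat 1")
  case True
  then have kl: "k + l = 2" and \<alpha>\<beta>: "\<alpha> ** \<beta> = mat 1" and \<beta>\<alpha>: "\<beta> ** \<alpha> = mat 1"
    by (auto simp: matrix_left_right_inverse)
  define F where "F = (\<lambda>z. f z * slash l g \<beta> z)"
  have F: "F \<in> uhp_holomorphic"
    unfolding F_def by (intro uhp_holomorphic_mult slash_uhp_holomorphic f g \<beta>)
  have "slash 2 F \<alpha> = (\<lambda>z. g z * slash k f \<alpha> z)"
    using slash_mult[OF \<alpha>, of k l f "slash l g \<beta>"]
    by (simp add: F_def kl slash_slash \<alpha> \<beta> \<beta>\<alpha> slash_mat_1 g mult.commute)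
  then have "contour_integral (linepath z0 (moebius \<beta> z0)) (\<lambda>z. g z * slash k f \<alpha> z)
      = contour_integral (linepath (moebius \<alpha> z0) z0) F"
    using contour_integral_slash_2[OF F \<alpha> z0 moebius_in_uhp[OF \<beta> z0]]
    by (simp add: moebius_inverse[OF \<alpha> \<beta> \<alpha>\<beta> z0])
  also have "\<dots> = - contour_integral (linepath z0 (moebius \<alpha> z0)) F"
    by (rule uhp_contour_integral_reverse[OF F z0 moebius_in_uhp[OF \<alpha> z0]])
  finally show ?thesis
    using kl \<alpha>\<beta> \<beta>\<alpha> by (simp add: tau0_monomial_def F_def add.commute)
next
  case False
  then have "\<not> (l + k = 2 \<and> \<beta> ** \<alpha> = mat 1)"
    by (simp add: add.commute matrix_left_right_inverse)
  with False show ?thesis by (simp add: tau0_monomial_def del: de_Morgan_conj)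
qed

lemma tau0_cyclic:
  assumes "a \<in> holomorphic_crossed" "b \<in> holomorphic_crossed"
  shows "tau0 z0 a b = - tau0 z0 b a"
  using assms(1)
proof (induction a rule: crossed_over_induct)
  case (monomial k f \<alpha>)
  have m: "monomial k f \<alpha> \<in> holomorphic_crossed"
    using monomial by (intro monomial_in_crossed_over)
  from assms(2) show ?case
    by (induction b rule: crossed_over_induct)
       (simp_all add: tau0_zero tau0_add_left tau0_add_right m tau0_monomial_eq_tau0
         tau0_monomial_cyclic[OF monomial])
qed (simp_all add: tau0_zero tau0_add_left tau0_add_right assms(2))

text \<open>
  If the weights add up to 2 and \<open>\<alpha>\<beta>\<gamma> = 1\<close>, the three terms are the integrals of one and the same
  form \<open>F dz\<close> over the sides of the triangle \<open>z\<^sub>0, \<alpha>z\<^sub>0, \<alpha>\<beta>z\<^sub>0\<close>; the third one is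
  brought to this form by the substitution \<open>\<gamma>\<close>.
\<close>

lemma tau0_monomial_hochschild:
  assumes f: "f \<in> uhp_holomorphic" and \<alpha>: "\<alpha> \<in> GL2Q_pos"
    and g: "g \<in> uhp_holomorphic" and \<beta>: "\<beta> \<in> GL2Q_pos"
    and h: "h \<in> uhp_holomorphic" and \<gamma>: "\<gamma> \<in> GL2Q_pos"
  shows "tau0_monomial z0 (k + l) (\<lambda>z. f z * slash l g (matrix_inv \<alpha>) z) (\<alpha> ** \<beta>) m h \<gamma>
    - tau0_monomial z0 k f \<alpha> (l + m) (\<lambda>z. g z * slash m h (matrix_inv \<beta>) z) (\<beta> ** \<gamma>)
    + tau0_monomial z0 (m + k) (\<lambda>z. h z * slash k f (matrix_inv \<gamma>) z) (\<gamma> ** \<alpha>) l g \<beta> = 0"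
proof (cases "k + l + m = 2 \<and> (\<alpha> ** \<beta>) ** \<gamma> = mat 1")
  case True
  then have w: "k + l + m = 2" and 1: "(\<alpha> ** \<beta>) ** \<gamma> = mat 1" by auto
  have 2: "\<alpha> ** (\<beta> ** \<gamma>) = mat 1" using 1 by (simp add: matrix_mul_assoc)
  have 3: "\<gamma> ** (\<alpha> ** \<beta>) = mat 1" using 1 by (simp add: matrix_left_right_inverse)
  have 4: "(\<gamma> ** \<alpha>) ** \<beta> = mat 1" using 3 by (simp add: matrix_mul_assoc)
  note inv = GL2Q_pos_inv
  \<comment> \<open>the common integrand \<open>f (g|\<alpha>\<^sup>-\<^sup>1) (h|(\<alpha>\<beta>)\<^sup>-\<^sup>1)\<close>\<close>
  define F where "F = (\<lambda>z. f z * slash l g (matrix_inv \<alpha>) z * slash m h \<gamma> z)"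
  have F: "F \<in> uhp_holomorphic"
    unfolding F_def by (intro uhp_holomorphic_mult slash_uhp_holomorphic f g h \<alpha> \<gamma> inv)
  have inv\<alpha>: "matrix_inv \<alpha> = \<beta> ** \<gamma>" by (rule matrix_inv_unique[OF 2])
  have \<beta>\<gamma>: "\<beta> ** \<gamma> \<in> GL2Q_pos" and \<alpha>\<beta>: "\<alpha> ** \<beta> \<in> GL2Q_pos"
    by (intro GL2Q_pos_mult \<alpha> \<beta> \<gamma>)+
  have "slash (l + m) (\<lambda>z. g z * slash m h (matrix_inv \<beta>) z) (\<beta> ** \<gamma>)
      = (\<lambda>z. slash l g (matrix_inv \<alpha>) z * slash m h \<gamma> z)"
    by (simp add: slash_mult[OF \<beta>\<gamma>] inv\<alpha> slash_slash \<beta>\<gamma> inv(1)[OF \<beta>] matrix_mul_assoc inv(3)[OF \<beta>])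
  then have t2: "f z * slash (l + m) (\<lambda>z. g z * slash m h (matrix_inv \<beta>) z) (\<beta> ** \<gamma>) z = F z" for z
    by (simp add: F_def mult.assoc)
  define G where "G = (\<lambda>z. h z * slash k f (matrix_inv \<gamma>) z * slash l g \<beta> z)"
  have G: "G \<in> uhp_holomorphic"
    unfolding G_def by (intro uhp_holomorphic_mult slash_uhp_holomorphic f g h \<beta> \<gamma> inv)
  have "slash (m + k + l) G \<gamma>
      = (\<lambda>z. slash m h \<gamma> z * slash k (slash k f (matrix_inv \<gamma>)) \<gamma> z * slash l (slash l g \<beta>) \<gamma> z)"
    unfolding G_def slash_mult[OF \<gamma>] ..
  then have "slash (m + k + l) G \<gamma> = F"
    by (simp add: slash_slash inv \<beta> \<gamma> slash_mat_1 f F_def inv\<alpha> mult.commute mult.left_commute)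
  moreover have "m + k + l = 2" using w by simp
  ultimately have "slash 2 G \<gamma> = F" by metis
  note z = z0 moebius_in_uhp[OF \<alpha> z0] moebius_in_uhp[OF \<alpha>\<beta> z0]
  have "moebius \<gamma> (moebius (\<alpha> ** \<beta>) z0) = z0"
    by (rule moebius_inverse[OF \<gamma> \<alpha>\<beta> 3 z0])
  then have t3: "contour_integral (linepath z0 (moebius (\<gamma> ** \<alpha>) z0)) G
      = contour_integral (linepath (moebius (\<alpha> ** \<beta>) z0) (moebius \<alpha> z0)) F"
    using contour_integral_slash_2[OF G \<gamma> z(3,2)] \<open>slash 2 G \<gamma> = F\<close>
    by (simp add: moebius_mult[OF \<gamma> \<alpha> z0])
  have t: "contour_integral (linepath z0 (moebius \<alpha> z0)) F
      = contour_integral (linepath z0 (moebius (\<alpha> ** \<beta>) z0)) F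
        + contour_integral (linepath (moebius (\<alpha> ** \<beta>) z0) (moebius \<alpha> z0)) F"
    by (rule uhp_contour_integral_split[OF F z(1,3,2), symmetric])
  have "k + (l + m) = 2" "m + k + l = 2" using w by simp_all
  then show ?thesis
    using w 1 2 4 by (simp add: tau0_monomial_def t t2 t3 F_def[symmetric] G_def[symmetric])
next
  case False
  have "(\<gamma> ** \<alpha>) ** \<beta> = mat 1 \<longleftrightarrow> (\<alpha> ** \<beta>) ** \<gamma> = mat 1"
    by (metis matrix_left_right_inverse matrix_mul_assoc)
  moreover have "k + (l + m) = k + l + m" "m + k + l = k + l + m" by simp_all
  ultimately show ?thesis
    using False by (auto simp add: tau0_monomial_def matrix_mul_assoc)
qed

lemma tau0_hochschild:
  assumes a: "a \<in> holomorphic_crossed" and b: "b \<in> holomorphic_crossed" and c: "c \<in> holomorphic_crossed"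
  shows "tau0 z0 (a \<odot> b) c - tau0 z0 a (b \<odot> c) + tau0 z0 (c \<odot> a) b = 0"
proof -
  note lin = tau0_zero tau0_add_left tau0_add_right crossed_mult_zero crossed_mult_add_left
    crossed_mult_add_right holomorphic_crossed_mult holomorphic_crossed_add
  have mm: "tau0 z0 (monomial k f \<alpha> \<odot> monomial l g \<beta>) c - tau0 z0 (monomial k f \<alpha>) (monomial l g \<beta> \<odot> c)
      + tau0 z0 (c \<odot> monomial k f \<alpha>) (monomial l g \<beta>) = 0"
    if fg: "f \<in> uhp_holomorphic" "\<alpha> \<in> GL2Q_pos" "g \<in> uhp_holomorphic" "\<beta> \<in> GL2Q_pos"
    for k f \<alpha> l g \<beta>
  proof -
    have m: "monomial k f \<alpha> \<in> holomorphic_crossed" "monomial l g \<beta> \<in> holomorphic_crossed"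
      using fg by (simp_all add: monomial_in_crossed_over)
    from c show ?thesis
    proof (induction c rule: crossed_over_induct)
      case (monomial n h \<gamma>)
      then show ?case
        using tau0_monomial_hochschild[OF fg monomial]
        by (simp add: crossed_mult_monomial tau0_monomial_eq_tau0)
    qed (use m in \<open>simp_all add: lin, simp add: algebra_simps\<close>)
  qed
  have m: "tau0 z0 (monomial k f \<alpha> \<odot> b) c - tau0 z0 (monomial k f \<alpha>) (b \<odot> c)
      + tau0 z0 (c \<odot> monomial k f \<alpha>) b = 0"
    if f: "f \<in> uhp_holomorphic" "\<alpha> \<in> GL2Q_pos" for k f \<alpha>
  proof -
    have m: "monomial k f \<alpha> \<in> holomorphic_crossed"
      using f by (simp add: monomial_in_crossed_over)
    from b show ?thesis
      by (induction b rule: crossed_over_induct)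
         (use m c mm[OF f] in \<open>simp_all add: lin\<close>, simp add: algebra_simps)
  qed
  from a show ?thesis
    by (induction a rule: crossed_over_induct)
       (use b c m in \<open>simp_all add: lin\<close>, simp add: algebra_simps)
qed

lemma cyclic_cocycle_tau0: "cyclic_cocycle (tau0 z0)"
  unfolding cyclic_cocycle_def bilinear_functional_def
  using crossed_product_subset
  by (auto simp: subset_iff tau0_add_left tau0_add_right tau0_scale tau0_hochschild
      intro: tau0_cyclic)

end

section \<open>The modular group\<close>

definition mat2 :: "int \<Rightarrow> int \<Rightarrow> int \<Rightarrow> int \<Rightarrow> rat^2^2" where
  "mat2 a b c d = vector [vector [of_int a, of_int b], vector [of_int c, of_int d]]"

lemma mat2_nth [simp]:
  "mat2 a b c d $ 1 $ 1 = of_int a" "mat2 a b c d $ 1 $ 2 = of_int b"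
  "mat2 a b c d $ 2 $ 1 = of_int c" "mat2 a b c d $ 2 $ 2 = of_int d"
  by (simp_all add: mat2_def)

lemma mat2_mult:
  "mat2 a b c d ** mat2 a' b' c' d'
    = mat2 (a * a' + b * c') (a * b' + b * d') (c * a' + d * c') (c * b' + d * d')"
  by (simp add: vec_eq_iff forall_2 matrix_matrix_mult_def sum_2)

lemma mat2_1: "mat2 1 0 0 1 = mat 1"
  by (simp add: vec_eq_iff forall_2 mat_def)

lemma mat2_in_SL2Z: "a * d - b * c = 1 \<Longrightarrow> mat2 a b c d \<in> SL2Z"
proof -
  assume "a * d - b * c = 1"
  then have "(of_int (a * d - b * c) :: rat) = 1" by simp
  then show ?thesis by (simp add: SL2Z_def det_2 forall_2)
qed

lemma SL2Z_cases:
  assumes "\<gamma> \<in> SL2Z"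
  obtains a b c d where "\<gamma> = mat2 a b c d" "a * d - b * c = 1"
proof -
  from assms obtain a b c d where entries: "\<gamma> $ 1 $ 1 = of_int a" "\<gamma> $ 1 $ 2 = of_int b"
    "\<gamma> $ 2 $ 1 = of_int c" "\<gamma> $ 2 $ 2 = of_int d" and det: "det \<gamma> = 1"
    by (auto simp: SL2Z_def Ints_def forall_2)
  then have "(of_int (a * d - b * c) :: rat) = of_int 1"
    by (simp add: det_2)
  then have "a * d - b * c = 1" by (simp only: of_int_eq_iff)
  moreover have "\<gamma> = mat2 a b c d"
    using entries by (simp add: vec_eq_iff forall_2)
  ultimately show thesis using that by blast
qed

lemma SL2Z_GL2Q_pos: "SL2Z \<subseteq> GL2Q_pos"
  by (auto simp: SL2Z_def GL2Q_pos_def)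

lemma mat_1_in_SL2Z: "mat 1 \<in> SL2Z"
  using mat2_in_SL2Z[of 1 1 0 0] by (simp add: mat2_1)

lemma mat2_inverse:
  assumes "a * d - b * c = 1"
  shows "mat2 a b c d ** mat2 d (- b) (- c) a = mat 1"
proof -
  have "a * d + b * - c = 1" "c * - b + d * a = 1"
    using assms by (simp_all add: algebra_simps)
  then show ?thesis by (simp add: mat2_mult algebra_simps flip: mat2_1)
qed

lemma SL2Z_inv:
  assumes "\<gamma> \<in> SL2Z"
  shows "matrix_inv \<gamma> \<in> SL2Z"
proof -
  obtain a b c d where \<gamma>: "\<gamma> = mat2 a b c d" and det: "a * d - b * c = 1"
    using SL2Z_cases[OF assms] .
  then have "matrix_inv \<gamma> = mat2 d (- b) (- c) a"
    using matrix_inv_unique mat2_inverse by blast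
  then show ?thesis using det by (simp add: mat2_in_SL2Z algebra_simps)
qed

lemma SL2Z_mult: "\<alpha> \<in> SL2Z \<Longrightarrow> \<beta> \<in> SL2Z \<Longrightarrow> \<alpha> ** \<beta> \<in> SL2Z"
  unfolding SL2Z_def by (simp add: det_mul) (simp add: forall_2 matrix_matrix_mult_def sum_2)

lemma mat2_congruent_Gamma_level:
  assumes det: "a * d - b * c = 1" "a' * d' - b' * c' = 1"
    and cong: "int N dvd a - a'" "int N dvd b - b'" "int N dvd c - c'" "int N dvd d - d'"
  shows "mat2 a b c d ** matrix_inv (mat2 a' b' c' d') \<in> Gamma_level N"
proof -
  let ?N = "int N"
  have inv: "matrix_inv (mat2 a' b' c' d') = mat2 d' (- b') (- c') a'"
    by (rule matrix_inv_unique[OF mat2_inverse[OF det(2)]])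
  obtain p q r s where e: "a = a' + ?N * p" "b = b' + ?N * q" "c = c' + ?N * r" "d = d' + ?N * s"
    using cong unfolding dvd_def by (metis add.commute diff_add_cancel)
  let ?\<delta> = "mat2 a b c d ** mat2 d' (- b') (- c') a'"
  have SL: "?\<delta> \<in> SL2Z"
    using det by (intro SL2Z_mult mat2_in_SL2Z) (simp_all add: algebra_simps)
  have "a * d' - b * c' = (a' * d' - b' * c') + (p * d' - q * c') * ?N"
    "b * a' - a * b' = (q * a' - p * b') * ?N"
    "c * d' - d * c' = (r * d' - s * c') * ?N"
    "d * a' - c * b' = (a' * d' - b' * c') + (s * a' - r * b') * ?N"
    unfolding e by (simp_all add: algebra_simps)
  moreover have "?\<delta> = mat2 (a * d' - b * c') (b * a' - a * b') (c * d' - d * c') (d * a' - c * b')"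
    by (simp add: mat2_mult mult.commute)
  ultimately obtain P Q R S where "?\<delta> = mat2 (1 + P * ?N) (Q * ?N) (R * ?N) (1 + S * ?N)"
    unfolding det(2) by metis
  then have "\<forall>i j. \<exists>m. ?\<delta> $ i $ j - mat 1 $ i $ j = of_int m * of_nat N"
    by (auto simp: forall_2 mat_def)
  with SL show ?thesis by (simp add: Gamma_level_def inv)
qed

lemma moebius_translation:
  "moebius (mat2 1 n 0 1) z = z + of_int n"
  by (simp add: moebius_def moebius_denom_def)

lemma slash_translation:
  assumes "z \<in> upper_half_plane"
  shows "slash k f (mat2 1 n 0 1) z = f (z + of_int n)"
  using assms by (simp add: slash_def on_uhp_def moebius_translation)
    (simp add: moebius_denom_def det_2)

text \<open>
  With \<open>y = Im z\<close> small, approximate \<open>Re z\<close> by a fraction \<open>h/c\<close> whose denominator is at most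
  about \<open>1 / \<surd>y\<close>. The bottom row \<open>(c, -h)\<close> then makes the denominator \<open>cz - h\<close> of the
  Moebius transformation as small as \<open>\<surd>(5y)\<close>.
\<close>

lemma SL2Z_orbit_Im_ge:
  assumes "z \<in> upper_half_plane"
  obtains \<gamma> where "\<gamma> \<in> SL2Z" "Im (moebius \<gamma> z) \<ge> 1 / 5"
proof (cases "Im z \<ge> 1 / 5")
  case True
  then show thesis using that[of "mat 1"] by (simp add: mat_1_in_SL2Z moebius_mat_1)
next
  case False
  define y where "y = Im z"
  have y: "0 < y" "y < 1" using assms False by (auto simp: y_def)
  then have sy: "0 < sqrt y" "sqrt y \<le> 1" "sqrt y * sqrt y = y" by auto
  \<comment> \<open>Of the two terms of \<open>\<bar>cz - h\<bar>\<^sup>2 \<le> 1/N\<^sup>2 + N\<^sup>2y\<^sup>2\<close>, this choice bounds the first by \<open>y\<close>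
    and the second by \<open>4y\<close>.\<close>
  define N where "N = nat \<lceil>1 / sqrt y\<rceil>"
  have N1: "1 / sqrt y \<le> N" unfolding N_def using sy by linarith
  have N2: "N \<le> 1 / sqrt y + 1" unfolding N_def using sy
    by (smt (verit) ceiling_correct divide_nonneg_nonneg of_int_nonneg of_nat_nat zero_le_ceiling)
  have "0 < 1 / sqrt y" using sy by simp
  with N1 have N0: "real N > 0" by linarith
  then obtain h c where hc: "coprime h c" "0 < c" "c \<le> int N" "\<bar>of_int c * Re z - of_int h\<bar> < 1 / N"
    using Dirichlet_approx_coprime[of N "Re z"] by auto
  obtain u v where uv: "u * h + v * c = 1"
    using bezout_int[of h c] hc(1) by auto
  define \<gamma> where "\<gamma> = mat2 (- u) (- v) c (- h)"
  have \<gamma>: "\<gamma> \<in> SL2Z"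
    unfolding \<gamma>_def using uv by (intro mat2_in_SL2Z) simp
  then have \<gamma>': "\<gamma> \<in> GL2Q_pos" using SL2Z_GL2Q_pos by blast
  have den: "(norm (moebius_denom \<gamma> z))\<^sup>2 = (c * Re z - h)\<^sup>2 + (c * y)\<^sup>2"
    by (simp add: \<gamma>_def moebius_denom_def cmod_power2 y_def of_rat_minus)
  have "1 / N \<le> sqrt y"
    using N1 sy N0 by (simp add: field_simps)
  then have "\<bar>c * Re z - h\<bar> \<le> sqrt y" using hc(4) by linarith
  then have 1: "(c * Re z - h)\<^sup>2 \<le> y"
    using sy by (metis abs_ge_zero power2_abs power2_eq_square power_mono)
  have "real N * sqrt y \<le> 1 + sqrt y"
    using mult_right_mono[OF N2, of "sqrt y"] sy by (simp add: field_simps)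
  with sy(2) have "real N * sqrt y \<le> 2" by linarith
  moreover have "real_of_int c \<le> real N" using hc(3) by linarith
  ultimately have "c * sqrt y \<le> 2"
    using sy by (meson mult_right_mono order.trans less_imp_le)
  then have "(c * sqrt y)\<^sup>2 \<le> 2\<^sup>2"
    using hc(2) sy by (intro power_mono) auto
  then have "c\<^sup>2 * y \<le> 4"
    using y by (simp add: power_mult_distrib)
  then have "(c * y)\<^sup>2 \<le> 4 * y"
    using mult_right_mono[of "c\<^sup>2 * y" 4 y] y by (simp add: power_mult_distrib power2_eq_square mult_ac)
  with 1 den have "(norm (moebius_denom \<gamma> z))\<^sup>2 \<le> 5 * y" by linarith
  moreover have "norm (moebius_denom \<gamma> z) > 0"
    using moebius_denom_nonzero[OF \<gamma>' assms] by simp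
  moreover have "det \<gamma> = 1" using \<gamma> by (simp add: SL2Z_def)
  ultimately have "Im (moebius \<gamma> z) \<ge> 1 / 5"
    by (simp add: Im_moebius y_def field_simps)
  with \<gamma> show thesis using that by blast
qed

section \<open>A maximum principle on half planes\<close>

text \<open>
  Dividing by \<open>1 - \<i>\<epsilon>(z - \<i>b)\<close>, which has modulus at least 1 on the half plane and grows at
  infinity, makes the function small on large half circles, so that the maximum principle applies
  on half discs; then \<open>\<epsilon>\<close> tends to 0.
\<close>

lemma half_plane_maximum:
  fixes f :: "complex \<Rightarrow> complex"
  assumes f: "f holomorphic_on upper_half_plane" and b: "0 < b"
    and bounded: "\<And>z. b \<le> Im z \<Longrightarrow> norm (f z) \<le> C"
    and line: "\<And>z. Im z = b \<Longrightarrow> norm (f z) \<le> M"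
    and w: "b \<le> Im w"
  shows "norm (f w) \<le> M"
proof -
  define p where "p = \<i> * of_real b"
  have M: "0 \<le> M" using order_trans[OF norm_ge_zero line[of p]] by (simp add: p_def)
  have C: "0 \<le> C" using order_trans[OF norm_ge_zero bounded[of p]] by (simp add: p_def)
  have den: "norm (1 - \<i> * of_real \<epsilon> * (z - p)) \<ge> 1"
      "norm (1 - \<i> * of_real \<epsilon> * (z - p)) \<ge> \<epsilon> * norm (z - p)"
    if "0 < \<epsilon>" "b \<le> Im z" for \<epsilon> z
  proof -
    have 0: "0 \<le> \<epsilon> * (Im z - b)" using that by simp
    have sq: "(norm (1 - \<i> * of_real \<epsilon> * (z - p)))\<^sup>2 = (1 + \<epsilon> * (Im z - b))\<^sup>2 + (\<epsilon> * Re z)\<^sup>2"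
      by (simp add: cmod_power2 p_def)
    have "1\<^sup>2 \<le> (1 + \<epsilon> * (Im z - b))\<^sup>2" using 0 by (intro power_mono) auto
    then have "1\<^sup>2 \<le> (norm (1 - \<i> * of_real \<epsilon> * (z - p)))\<^sup>2"
      unfolding sq by (simp add: add_increasing2)
    then show "norm (1 - \<i> * of_real \<epsilon> * (z - p)) \<ge> 1"
      by (rule power2_le_imp_le) simp
    have "(\<epsilon> * (Im z - b))\<^sup>2 \<le> (1 + \<epsilon> * (Im z - b))\<^sup>2" using 0 by (intro power_mono) auto
    then have "(\<epsilon> * norm (z - p))\<^sup>2 \<le> (norm (1 - \<i> * of_real \<epsilon> * (z - p)))\<^sup>2"
      unfolding sq by (simp add: power_mult_distrib cmod_power2 p_def distrib_left)
    then show "norm (1 - \<i> * of_real \<epsilon> * (z - p)) \<ge> \<epsilon> * norm (z - p)"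
      by (rule power2_le_imp_le) simp
  qed
  have est: "norm (f w) \<le> (M + \<epsilon>) * norm (1 - \<i> * of_real \<epsilon> * (w - p))" if \<epsilon>: "0 < \<epsilon>" for \<epsilon>
  proof -
    define g where "g z = f z / (1 - \<i> * of_real \<epsilon> * (z - p))" for z
    \<comment> \<open>large enough for \<open>w\<close> to lie inside, and for \<open>C/(\<epsilon>R) \<le> \<epsilon>\<close> on the half circle\<close>
    define R where "R = norm (w - p) + C / (\<epsilon> * \<epsilon>) + 1"
    have R: "norm (w - p) < R" "0 < R" "C / (\<epsilon> * \<epsilon>) \<le> R"
      using C \<epsilon> by (auto simp: R_def add_nonneg_pos add.assoc)
    define S where "S = {z. b \<le> Im z} \<inter> cball p R"
    have S: "closed S"
      unfolding S_def using closed_halfspace_Im_ge[of b] by (simp add: closed_Int)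
    have nz: "1 - \<i> * of_real \<epsilon> * (z - p) \<noteq> 0" if "b \<le> Im z" for z
      using den(1)[OF \<epsilon> that] by auto
    have g: "g holomorphic_on {z. b \<le> Im z}"
      unfolding g_def
      by (intro holomorphic_intros holomorphic_on_subset[OF f]) (use b nz in auto)
    have "norm (g w) \<le> M + \<epsilon>"
    proof (rule maximum_modulus_frontier[of g S])
      show "g holomorphic_on interior S"
        using interior_subset[of S] by (intro holomorphic_on_subset[OF g]) (auto simp: S_def)
      show "continuous_on (closure S) g"
        using S by (intro holomorphic_on_imp_continuous_on holomorphic_on_subset[OF g])
          (auto simp: S_def)
      show "bounded S" unfolding S_def by (simp add: bounded_Int)
      show "w \<in> S" using w R by (simp add: S_def dist_norm norm_minus_commute)
      fix z assume "z \<in> frontier S"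
      then have z: "z \<in> S" "z \<notin> interior S"
        using S by (auto simp: frontier_def)
      then have Im: "b \<le> Im z" by (simp add: S_def)
      have "Im z = b \<or> norm (z - p) = R"
      proof (rule ccontr)
        assume "\<not> ?thesis"
        then have "z \<in> {z. b < Im z} \<inter> ball p R"
          using z(1) by (auto simp: S_def dist_norm norm_minus_commute)
        moreover have "open ({z. b < Im z} \<inter> ball p R)"
          using open_halfspace_Im_gt[of b] by (simp add: open_Int)
        moreover have "{z. b < Im z} \<inter> ball p R \<subseteq> S" by (auto simp: S_def)
        ultimately show False using z(2) interiorI by blast
      qed
      then show "norm (g z) \<le> M + \<epsilon>"
      proof
        assume "Im z = b"
        then have "norm (f z) \<le> M * norm (1 - \<i> * of_real \<epsilon> * (z - p))"
          using line[of z] mult_left_mono[OF den(1)[OF \<epsilon> Im] M] by simp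
        then have "norm (g z) \<le> M"
          using nz[OF Im] by (simp add: g_def norm_divide divide_le_eq)
        then show ?thesis using \<epsilon> by simp
      next
        assume zR: "norm (z - p) = R"
        have "C \<le> \<epsilon> * (\<epsilon> * R)"
          using R(3) \<epsilon> by (simp add: divide_le_eq mult_ac)
        also have "\<dots> \<le> \<epsilon> * norm (1 - \<i> * of_real \<epsilon> * (z - p))"
          using den(2)[OF \<epsilon> Im] \<epsilon> zR by simp
        finally have "norm (f z) \<le> \<epsilon> * norm (1 - \<i> * of_real \<epsilon> * (z - p))"
          using bounded[OF Im] by simp
        then have "norm (g z) \<le> \<epsilon>"
          using nz[OF Im] by (simp add: g_def norm_divide divide_le_eq)
        then show ?thesis using M by simp
      qed
    qed
    then show ?thesis
      using nz[OF w] by (simp add: g_def norm_divide divide_le_eq)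
  qed
  have lim: "((\<lambda>\<epsilon>. (M + \<epsilon>) * norm (1 - \<i> * of_real \<epsilon> * (w - p)))
      \<longlongrightarrow> (M + 0) * norm (1 - \<i> * of_real 0 * (w - p))) (at_right 0)"
    by (intro tendsto_intros)
  have "norm (f w) \<le> (M + 0) * norm (1 - \<i> * of_real 0 * (w - p))"
    by (rule tendsto_lowerbound[OF lim eventually_mono[OF eventually_at_right_less]]) (auto intro!: est)
  then show ?thesis by simp
qed

section \<open>Modular forms of weight at most zero\<close>

lemma finite_family_bounded:
  fixes S :: "('a \<Rightarrow> complex) set"
  assumes "finite S" "\<And>s. s \<in> S \<Longrightarrow> \<exists>C. \<forall>x\<in>X. norm (s x) \<le> C"
  shows "\<exists>C. \<forall>s\<in>S. \<forall>x\<in>X. norm (s x) \<le> C"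
  using assms
proof (induction S rule: finite_induct)
  case (insert s S)
  then obtain C C' where "\<forall>s\<in>S. \<forall>x\<in>X. norm (s x) \<le> C" "\<forall>x\<in>X. norm (s x) \<le> C'"
    by (metis insertCI)
  then have "\<forall>s'\<in>insert s S. \<forall>x\<in>X. norm (s' x) \<le> max C C'" by fastforce
  then show ?case by blast
qed simp

context
  fixes N :: nat and k :: int and f :: "complex \<Rightarrow> complex"
  assumes N: "N \<ge> 1" and f: "f \<in> modular_forms_level N k"
begin

abbreviation translates :: "(complex \<Rightarrow> complex) set" where
  "translates \<equiv> slash k f ` SL2Z"

lemma f_uhp_holomorphic: "f \<in> uhp_holomorphic"
  using f by (auto simp: modular_forms_level_def uhp_holomorphic_def)

lemma translates_uhp_holomorphic: "s \<in> translates \<Longrightarrow> s \<in> uhp_holomorphic"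
  using slash_uhp_holomorphic[OF f_uhp_holomorphic] SL2Z_GL2Q_pos by blast

lemma f_in_translates: "f \<in> translates"
  using slash_mat_1[OF f_uhp_holomorphic] mat_1_in_SL2Z by (metis imageI)

lemma translates_slash: "s \<in> translates \<Longrightarrow> \<gamma> \<in> SL2Z \<Longrightarrow> slash k s \<gamma> \<in> translates"
  using slash_slash SL2Z_mult SL2Z_GL2Q_pos by (auto simp: subset_iff)

text \<open>
  Matrices whose entries have the same residues modulo \<open>N\<close> differ by a factor in \<open>\<Gamma>(N)\<close> on the
  left, which fixes \<open>f\<close>. So there are at most \<open>N\<^sup>4\<close> translates.
\<close>

lemma finite_translates: "finite translates"
proof -
  define r :: "rat^2^2 \<Rightarrow> int \<times> int \<times> int \<times> int" where
    "r \<gamma> = (\<lfloor>\<gamma> $ 1 $ 1\<rfloor> mod int N, \<lfloor>\<gamma> $ 1 $ 2\<rfloor> mod int N, \<lfloor>\<gamma> $ 2 $ 1\<rfloor> mod int N, \<lfloor>\<gamma> $ 2 $ 2\<rfloor> mod int N)"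
    for \<gamma>
  let ?I = "{0..<int N}"
  have "r ` SL2Z \<subseteq> ?I \<times> ?I \<times> ?I \<times> ?I" using N by (auto simp: r_def)
  then have fin: "finite (r ` SL2Z)" by (rule finite_subset) simp
  have eq: "slash k f \<gamma> = slash k f \<gamma>'" if \<gamma>: "\<gamma> \<in> SL2Z" "\<gamma>' \<in> SL2Z" "r \<gamma> = r \<gamma>'" for \<gamma> \<gamma>'
  proof -
    obtain a b c d where 1: "\<gamma> = mat2 a b c d" "a * d - b * c = 1" using SL2Z_cases[OF \<gamma>(1)] .
    obtain a' b' c' d' where 2: "\<gamma>' = mat2 a' b' c' d'" "a' * d' - b' * c' = 1"
      using SL2Z_cases[OF \<gamma>(2)] .
    let ?\<delta> = "\<gamma> ** matrix_inv \<gamma>'"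
    have \<delta>: "?\<delta> \<in> Gamma_level N"
      using \<gamma>(3) unfolding 1 2
      by (intro mat2_congruent_Gamma_level 1 2) (simp_all add: r_def mod_eq_dvd_iff)
    then have GL: "?\<delta> \<in> GL2Q_pos" "\<gamma>' \<in> GL2Q_pos"
      using \<gamma>(2) SL2Z_GL2Q_pos by (auto simp: Gamma_level_def)
    have "?\<delta> ** \<gamma>' = \<gamma>"
      using GL2Q_pos_inv(3)[OF GL(2)] by (simp flip: matrix_mul_assoc)
    then have "slash k f \<gamma> = slash k (slash k f ?\<delta>) \<gamma>'"
      using slash_slash[OF GL] by simp
    also have "slash k f ?\<delta> = f" using f \<delta> by (simp add: modular_forms_level_def)
    finally show ?thesis .
  qed
  define s where "s t = slash k f (SOME \<gamma>. \<gamma> \<in> SL2Z \<and> r \<gamma> = t)" for t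
  have "slash k f \<gamma> = s (r \<gamma>)" if "\<gamma> \<in> SL2Z" for \<gamma>
    unfolding s_def by (rule eq) (use that someI[of "\<lambda>x. x \<in> SL2Z \<and> r x = r \<gamma>" \<gamma>] in auto)
  then have "translates \<subseteq> s ` r ` SL2Z" by auto
  then show ?thesis using fin by (meson finite_imageI finite_subset)
qed

text \<open>
  Integral translations permute the translates of \<open>f\<close>. So bounds for all of them are only needed
  on the strip \<open>\<bar>Re z\<bar> \<le> 1\<close>, whose bounded horizontal pieces are compact.
\<close>

lemma translates_strip:
  assumes "s \<in> translates" "z \<in> upper_half_plane"
  obtains s' z' where "s' \<in> translates" "s z = s' z'" "Im z' = Im z" "\<bar>Re z'\<bar> \<le> 1"
proof
  let ?n = "\<lfloor>Re z\<rfloor>"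
  show "slash k s (mat2 1 ?n 0 1) \<in> translates"
    by (intro translates_slash assms mat2_in_SL2Z) simp
  show "s z = slash k s (mat2 1 ?n 0 1) (z - of_int ?n)"
    using assms(2) by (subst slash_translation) auto
  show "Im (z - of_int ?n) = Im z" by simp
  show "\<bar>Re (z - of_int ?n)\<bar> \<le> 1" by simp linarith
qed

text \<open>
  Near the cusp this is the growth condition on modular forms; the rest of the strip is compact.
\<close>

lemma translates_bounded:
  assumes b: "0 < b"
  obtains C where "\<And>s z. s \<in> translates \<Longrightarrow> b \<le> Im z \<Longrightarrow> norm (s z) \<le> C"
proof -
  let ?X = "{z. b \<le> Im z \<and> \<bar>Re z\<bar> \<le> 1}"
  have "\<exists>C. \<forall>z\<in>?X. norm (s z) \<le> C" if s: "s \<in> translates" for s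
  proof -
    have "\<exists>B C. \<forall>z. B \<le> Im z \<longrightarrow> norm (s z) \<le> C"
      using s f by (auto simp: modular_forms_level_def)
    then obtain B C where C: "\<And>z. B \<le> Im z \<Longrightarrow> norm (s z) \<le> C" by blast
    let ?K = "cbox (Complex (-1) b) (Complex 1 B)"
    have "?K \<subseteq> upper_half_plane" using b by (auto simp: in_cbox_complex_iff)
    then have "continuous_on ?K s"
      using uhp_holomorphicD(1)[OF translates_uhp_holomorphic[OF s]]
      by (meson holomorphic_on_imp_continuous_on holomorphic_on_subset)
    then have "bounded (s ` ?K)"
      by (intro compact_imp_bounded compact_continuous_image compact_cbox)
    then obtain C' where C': "\<And>z. z \<in> ?K \<Longrightarrow> norm (s z) \<le> C'"
      by (auto simp: bounded_iff)
    have "norm (s z) \<le> max C C'" if z: "z \<in> ?X" for z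
    proof (cases "B \<le> Im z")
      case True
      then show ?thesis using C[of z] by simp
    next
      case False
      then have "z \<in> ?K" using z by (auto simp: in_cbox_complex_iff)
      then show ?thesis using C'[of z] by simp
    qed
    then show ?thesis by blast
  qed
  from finite_family_bounded[OF finite_translates this]
  obtain C where C: "\<And>s z. s \<in> translates \<Longrightarrow> z \<in> ?X \<Longrightarrow> norm (s z) \<le> C" by blast
  show thesis
  proof
    fix s z assume sz: "s \<in> translates" "b \<le> Im z"
    then have "z \<in> upper_half_plane" using b by simp
    then obtain s' z' where "s' \<in> translates" "s z = s' z'" "Im z' = Im z" "\<bar>Re z'\<bar> \<le> 1"
      using translates_strip[OF sz(1)] by blast
    then show "norm (s z) \<le> C" using C[of s' z'] sz(2) by simp
  qed
qed

lemma translates_orbit: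
  assumes s: "s \<in> translates" and z: "z \<in> upper_half_plane"
  obtains s' \<gamma> where "s' \<in> translates" "\<gamma> \<in> SL2Z" "1 / 5 \<le> Im (moebius \<gamma> z)"
    "s z = moebius_denom \<gamma> z powi (- k) * s' (moebius \<gamma> z)"
proof -
  obtain \<gamma> where \<gamma>: "\<gamma> \<in> SL2Z" "1 / 5 \<le> Im (moebius \<gamma> z)" using SL2Z_orbit_Im_ge[OF z] .
  then have GL: "\<gamma> \<in> GL2Q_pos" using SL2Z_GL2Q_pos by blast
  have "slash k (slash k s (matrix_inv \<gamma>)) \<gamma> = s"
    using GL by (simp add: slash_slash GL2Q_pos_inv slash_mat_1 translates_uhp_holomorphic s)
  then have "s z = slash k (slash k s (matrix_inv \<gamma>)) \<gamma> z" by simp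
  also have "\<dots> = moebius_denom \<gamma> z powi (- k) * slash k s (matrix_inv \<gamma>) (moebius \<gamma> z)"
    using z \<gamma>(1) by (subst slash_eq) (simp_all add: automorphy_factor_def SL2Z_def)
  finally show thesis
    using that[OF translates_slash[OF s SL2Z_inv[OF \<gamma>(1)]] \<gamma>] by blast
qed

text \<open>
  For negative weight the growth estimate \<open>\<bar>f z\<bar> \<le> C (5 Im z)\<^bsup>-k/2\<^esup>\<close> forces \<open>f\<close> to tend to 0
  uniformly at the real line, and the maximum principle propagates this to the half plane.
\<close>

lemma negative_weight_zero:
  assumes k: "k < 0"
  shows "f = 0"
proof -
  define m where "m = nat (- k)"
  have m: "- k = int m" "0 < m" using k by (auto simp: m_def)
  obtain C where C: "\<And>s z. s \<in> translates \<Longrightarrow> 1 / 5 \<le> Im z \<Longrightarrow> norm (s z) \<le> C"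
    using translates_bounded[of "1 / 5"] by auto
  have C0: "0 \<le> C" using order_trans[OF norm_ge_zero C[OF f_in_translates, of \<i>]] by simp
  have growth: "norm (f z) \<le> C * sqrt (5 * Im z) ^ m" if z: "z \<in> upper_half_plane" for z
  proof -
    obtain s \<gamma> where s: "s \<in> translates" "\<gamma> \<in> SL2Z" "1 / 5 \<le> Im (moebius \<gamma> z)"
      "f z = moebius_denom \<gamma> z powi (- k) * s (moebius \<gamma> z)"
      using translates_orbit[OF f_in_translates z] .
    let ?j = "norm (moebius_denom \<gamma> z)"
    have "?j > 0" using moebius_denom_nonzero[OF _ z] s(2) SL2Z_GL2Q_pos by auto
    moreover have "det \<gamma> = 1" using s(2) by (simp add: SL2Z_def)
    ultimately have "?j\<^sup>2 \<le> 5 * Im z" using s(3) by (simp add: Im_moebius field_simps)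
    then have "?j \<le> sqrt (5 * Im z)" by (rule real_le_rsqrt)
    then have "?j ^ m \<le> sqrt (5 * Im z) ^ m" by (intro power_mono) auto
    moreover have "norm (f z) = ?j ^ m * norm (s (moebius \<gamma> z))"
      unfolding s(4) by (simp add: m norm_mult norm_power)
    ultimately show ?thesis
      using C[OF s(1,3)] z
      by (metis mult.commute mult_mono norm_ge_zero zero_le_power power_mono C0)
  qed
  have small: "norm (f w) \<le> C * sqrt (5 * b) ^ m" if b: "0 < b" "b \<le> Im w" for w b
  proof -
    obtain C' where C': "\<And>s z. s \<in> translates \<Longrightarrow> b \<le> Im z \<Longrightarrow> norm (s z) \<le> C'"
      using translates_bounded[OF b(1)] by blast
    show ?thesis
    proof (rule half_plane_maximum[OF uhp_holomorphicD(1)[OF f_uhp_holomorphic] b(1) C'[OF f_in_translates] _ b(2)])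
      show "norm (f z) \<le> C * sqrt (5 * b) ^ m" if "Im z = b" for z
        using growth[of z] that b(1) by simp
    qed
  qed
  have "f w = 0" if w: "w \<in> upper_half_plane" for w
  proof -
    have lim: "((\<lambda>b. C * sqrt (5 * b) ^ m) \<longlongrightarrow> C * sqrt (5 * 0) ^ m) (at_right 0)"
      by (intro tendsto_intros)
    have ev: "\<forall>\<^sub>F b in at_right 0. b \<in> {0<..<Im w}"
      by (rule eventually_at_right_real) (use w in simp)
    have "norm (f w) \<le> C * sqrt (5 * 0) ^ m"
      by (rule tendsto_lowerbound[OF lim eventually_mono[OF ev]]) (auto intro!: small)
    then show ?thesis using m(2) by (simp add: power_0_left)
  qed
  then show ?thesis using uhp_holomorphicD(2)[OF f_uhp_holomorphic] by fastforce
qed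

text \<open>
  For weight 0 the maximum of the moduli of the translates on the line \<open>Im z = 1/5\<close> exists, since
  a compact piece of that line suffices; by the maximum principle it bounds them on
  \<open>Im z \<ge> 1/5\<close>, hence everywhere. So some translate has an interior maximum.
\<close>

lemma weight_zero_constant:
  assumes k: "k = 0"
  obtains c where "f = on_uhp (\<lambda>_. c)"
proof -
  define K where "K = {z. Im z = 1 / 5 \<and> \<bar>Re z\<bar> \<le> 1}"
  have "K = cbox (Complex (-1) (1 / 5)) (Complex 1 (1 / 5))"
    by (auto simp: K_def in_cbox_complex_iff)
  then have "compact K" by simp
  moreover have "Complex 0 (1 / 5) \<in> K" by (simp add: K_def)
  moreover have "K \<subseteq> upper_half_plane" by (auto simp: K_def)
  ultimately have K: "compact K" "K \<noteq> {}" "K \<subseteq> upper_half_plane" by auto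
  have "\<exists>w\<in>K. \<forall>z\<in>K. norm (s z) \<le> norm (s w)" if "s \<in> translates" for s
  proof (rule continuous_attains_sup[OF K(1,2)])
    show "continuous_on K (\<lambda>z. norm (s z))"
      using uhp_holomorphicD(1)[OF translates_uhp_holomorphic[OF that]] K(3)
      by (intro continuous_on_norm) (meson holomorphic_on_imp_continuous_on holomorphic_on_subset)
  qed
  then obtain w where w: "\<And>s. s \<in> translates \<Longrightarrow> w s \<in> K"
    "\<And>s z. s \<in> translates \<Longrightarrow> z \<in> K \<Longrightarrow> norm (s z) \<le> norm (s (w s))"
    by metis
  obtain s0 where s0: "s0 \<in> translates" "Max ((\<lambda>s. norm (s (w s))) ` translates) = norm (s0 (w s0))"
    using obtains_MAX[OF finite_translates, of "\<lambda>s. norm (s (w s))"] f_in_translates by blast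
  define M where "M = norm (s0 (w s0))"
  have MK: "norm (s z) \<le> M" if "s \<in> translates" "z \<in> K" for s z
  proof -
    have "norm (s (w s)) \<le> M"
      unfolding M_def s0(2)[symmetric] using that finite_translates by (intro Max_ge) auto
    with w(2)[OF that] show ?thesis by simp
  qed
  have line: "norm (s z) \<le> M" if s: "s \<in> translates" and z: "Im z = 1 / 5" for s z
  proof -
    have "z \<in> upper_half_plane" using z by simp
    then obtain s' z' where "s' \<in> translates" "s z = s' z'" "Im z' = Im z" "\<bar>Re z'\<bar> \<le> 1"
      using translates_strip[OF s] by blast
    then show ?thesis using MK[of s' z'] z by (simp add: K_def)
  qed
  obtain C where C: "\<And>s z. s \<in> translates \<Longrightarrow> 1 / 5 \<le> Im z \<Longrightarrow> norm (s z) \<le> C"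
    using translates_bounded[of "1 / 5"] by auto
  have above: "norm (s z) \<le> M" if s: "s \<in> translates" and z: "1 / 5 \<le> Im z" for s z
    using half_plane_maximum[OF uhp_holomorphicD(1)[OF translates_uhp_holomorphic[OF s]] _ C[OF s] line[OF s] z]
    by simp
  have "norm (s0 z) \<le> norm (s0 (w s0))" if z: "z \<in> upper_half_plane" for z
  proof -
    obtain s \<gamma> where "s \<in> translates" "1 / 5 \<le> Im (moebius \<gamma> z)"
      "s0 z = moebius_denom \<gamma> z powi (- k) * s (moebius \<gamma> z)"
      using translates_orbit[OF s0(1) z] .
    then show ?thesis using above[of s "moebius \<gamma> z"] by (simp add: k M_def)
  qed
  moreover have "w s0 \<in> upper_half_plane" using w(1)[OF s0(1)] K(3) by blast
  ultimately have "s0 constant_on upper_half_plane"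
    using maximum_modulus_principle[OF uhp_holomorphicD(1)[OF translates_uhp_holomorphic[OF s0(1)]]
        open_uhp convex_connected[OF convex_uhp] open_uhp order_refl] by blast
  then obtain c where c: "\<And>z. z \<in> upper_half_plane \<Longrightarrow> s0 z = c" by (auto simp: constant_on_def)
  obtain \<gamma> where \<gamma>: "\<gamma> \<in> SL2Z" "s0 = slash k f \<gamma>" using s0(1) by blast
  then have GL: "\<gamma> \<in> GL2Q_pos" using SL2Z_GL2Q_pos by blast
  note inv = GL2Q_pos_inv[OF GL]
  have "f = slash 0 s0 (matrix_inv \<gamma>)"
    using k inv GL f_uhp_holomorphic by (simp add: \<gamma>(2) slash_slash slash_mat_1)
  also have "\<dots> = on_uhp (\<lambda>_. c)"
  proof
    fix z
    show "slash 0 s0 (matrix_inv \<gamma>) z = on_uhp (\<lambda>_. c) z"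
      using c[OF moebius_in_uhp[OF inv(1)]] automorphy_factor_0[OF inv(1)]
      by (cases "z \<in> upper_half_plane") (simp_all add: slash_eq slash_outside on_uhp_def)
  qed
  finally show thesis using that by blast
qed

end

lemma modular_forms_negative: "f \<in> modular_forms k \<Longrightarrow> k < 0 \<Longrightarrow> f = 0"
  using negative_weight_zero by (auto simp: modular_forms_def)

lemma modular_forms_0_constant:
  assumes "f \<in> modular_forms 0"
  obtains c where "f = on_uhp (\<lambda>_. c)"
proof -
  obtain N where "1 \<le> N" "f \<in> modular_forms_level N 0"
    using assms by (auto simp: modular_forms_def)
  then show thesis using that by (rule weight_zero_constant[OF _ _ refl])
qed

lemma slash_0_constant:
  assumes "\<gamma> \<in> GL2Q_pos"
  shows "slash 0 (on_uhp (\<lambda>_. c)) \<gamma> = on_uhp (\<lambda>_. c)"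
proof
  fix z
  show "slash 0 (on_uhp (\<lambda>_. c)) \<gamma> z = on_uhp (\<lambda>_. c) z"
    using moebius_in_uhp[OF assms, of z] automorphy_factor_0[OF assms]
    by (cases "z \<in> upper_half_plane") (simp_all add: slash_eq slash_outside on_uhp_def)
qed

lemma constant_in_modular_forms_0: "on_uhp (\<lambda>_. c) \<in> modular_forms 0"
proof -
  have hol: "on_uhp (\<lambda>_. c) holomorphic_on upper_half_plane"
    by (rule holomorphic_transform[OF holomorphic_on_const[of c]]) (simp add: on_uhp_def)
  have bound: "\<exists>B C. \<forall>z. B \<le> Im z \<longrightarrow> norm (on_uhp (\<lambda>_. c) z) \<le> C"
    by (intro exI[of _ 0] exI[of _ "norm c"]) (simp add: on_uhp_def)
  have "SL2Z \<subseteq> GL2Q_pos" "Gamma_level 1 \<subseteq> GL2Q_pos"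
    using SL2Z_GL2Q_pos by (auto simp: Gamma_level_def)
  then have "slash 0 (on_uhp (\<lambda>_. c)) \<gamma> = on_uhp (\<lambda>_. c)" if "\<gamma> \<in> SL2Z \<union> Gamma_level 1" for \<gamma>
    using that slash_0_constant by blast
  moreover have "on_uhp (\<lambda>_. c) z = 0" if "z \<notin> upper_half_plane" for z
    using that by (simp add: on_uhp_def)
  ultimately have "on_uhp (\<lambda>_. c) \<in> modular_forms_level 1 0"
    using hol bound unfolding modular_forms_level_def by simp
  then show ?thesis by (auto simp: modular_forms_def)
qed

section \<open>Functionals on the tensor product\<close>

text \<open>
  The functional is defined on the free vector space spanned by the pairs. It vanishes on the whole
  two-sided ideal because a bilinearity relator, multiplied by pairs on both sides, is again such a
  relator, with entries \<open>x a x'\<close> and \<open>y b y'\<close>.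
\<close>

lemma tensor_lift_exists:
  fixes B :: "'a::complex_algebra \<Rightarrow> 'b::complex_algebra \<Rightarrow> complex"
  assumes B: "\<And>a a' b. B (a + a') b = B a b + B a' b" "\<And>a b b'. B a (b + b') = B a b + B a b'"
    "\<And>c a b. B (c *c a) b = c * B a b" "\<And>c a b. B a (c *c b) = c * B a b"
  shows "\<exists>L. (\<forall>s t. L (s + t) = L s + L t) \<and> (\<forall>a b. L (a \<otimes> b) = B a b)"
proof -
  define val :: "'a multiplicative \<times> 'b multiplicative \<Rightarrow> complex \<Rightarrow> complex" where
    "val x c = c * B (unmult (fst x)) (unmult (snd x))" for x c
  define l where "l p = (\<Sum>x\<in>Poly_Mapping.keys p. val x (Poly_Mapping.lookup p x))" for p
  have l_add: "l (p + q) = l p + l q" for p q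
    unfolding l_def by (rule sum_keys_add[of val]) (simp_all add: val_def distrib_right)
  have l_zero: "l 0 = 0" by (simp add: l_def)
  have l_diff: "l (p - q) = l p - l q" for p q
    using l_add[of "p - q" q] by simp
  have l_single: "l (Poly_Mapping.single x c) = val x c" for x c
    by (simp add: l_def val_def)
  have sandwich: "l (Poly_Mapping.single (Mult x, Mult y) c * free_pair a b
      * Poly_Mapping.single (Mult x', Mult y') c') = c * c' * B (x * a * x') (y * b * y')"
    for x y c a b x' y' c'
    by (simp add: free_pair_def mult_single l_single val_def plus_multiplicative_def)
  have sandwich_scaled: "l (Poly_Mapping.single (Mult x, Mult y) c * (Poly_Mapping.single 0 d * free_pair a b)
      * Poly_Mapping.single (Mult x', Mult y') c') = c * d * c' * B (x * a * x') (y * b * y')"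
    for x y c a b x' y' c' d
    by (simp add: free_pair_def mult_single l_single val_def plus_multiplicative_def)
  have rel: "l (p * r * q) = 0" if r: "r \<in> tensor_relators" for p q r
  proof (induction p rule: poly_mapping_single_induct)
    case (single u c)
    show ?case
    proof (induction q rule: poly_mapping_single_induct)
      case (single v c')
      obtain x y x' y' where [simp]: "u = (Mult x, Mult y)" "v = (Mult x', Mult y')"
        by (metis multiplicative.exhaust prod.exhaust)
      from r show ?case
        unfolding tensor_relators_def
        by (auto simp: left_diff_distrib right_diff_distrib l_diff sandwich sandwich_scaled B
            distrib_left distrib_right cscale_mult_left cscale_mult_right)
    qed (simp_all add: l_zero l_add distrib_left)
  qed (simp_all add: l_zero l_add distrib_right)
  have ideal: "l p = 0" if "p \<in> two_sided_ideal tensor_relators" for p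
    using that by induction (simp_all add: l_zero l_add rel)
  define L where "L t = l (rep_tensor t)" for t
  have L_abs: "L (abs_tensor p) = l p" for p
  proof -
    have "rep_tensor (abs_tensor p) - p \<in> two_sided_ideal tensor_relators"
      using Quotient_rep_abs[OF Quotient_tensor, of p] two_sided_ideal.zero by auto
    from ideal[OF this] show ?thesis by (simp add: L_def l_diff)
  qed
  have "L (s + t) = L s + L t" for s t
  proof -
    have "\<exists>p. s = abs_tensor p" for s :: "('a, 'b) tensor" by (rule tensor.abs_induct) blast
    then obtain p q where "s = abs_tensor p" "t = abs_tensor q" by meson
    then show ?thesis by (simp add: plus_tensor.abs_eq L_abs l_add)
  qed
  moreover have "L (a \<otimes> b) = B a b" for a b
    by (simp add: pure_tensor.abs_eq L_abs free_pair_def l_single val_def)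
  ultimately show ?thesis by blast
qed

text \<open>
  The value of a Sweedler sum does not depend on the list of pairs that represents the coproduct.
\<close>

lemma bilinear_sum_tensor_eq:
  fixes B :: "'a::complex_algebra \<Rightarrow> 'b::complex_algebra \<Rightarrow> complex"
  assumes B: "\<And>a a' b. B (a + a') b = B a b + B a' b" "\<And>a b b'. B a (b + b') = B a b + B a b'"
    "\<And>c a b. B (c *c a) b = c * B a b" "\<And>c a b. B a (c *c b) = c * B a b"
    and eq: "(\<Sum>(u, v)\<leftarrow>us. u \<otimes> v) = (\<Sum>(u, v)\<leftarrow>vs. u \<otimes> v)"
  shows "(\<Sum>(u, v)\<leftarrow>us. B u v) = (\<Sum>(u, v)\<leftarrow>vs. B u v)"
proof -
  obtain L where L: "\<And>s t. L (s + t) = L s + L t" "\<And>a b. L (a \<otimes> b) = B a b"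
    using tensor_lift_exists[of B] B by blast
  have "L 0 = 0" using L(1)[of 0 0] by simp
  then have "L (\<Sum>(u, v)\<leftarrow>ws. u \<otimes> v) = (\<Sum>(u, v)\<leftarrow>ws. B u v)" for ws
    by (induction ws) (auto simp: L)
  then show ?thesis using eq by metis
qed

section \<open>Generators and structure maps of the Hopf algebra\<close>

text \<open>
  The higher \<open>\<delta>\<^sub>n\<close> are iterated commutators of \<open>X\<close> with \<open>\<delta>\<^sub>1\<close>.
\<close>

lemma h1_generated [case_names one cscale add mult X Y delta1]:
  assumes "P 1" and cscale: "\<And>c x. P x \<Longrightarrow> P (c *c x)"
    and add: "\<And>x y. P x \<Longrightarrow> P y \<Longrightarrow> P (x + y)" and mult: "\<And>x y. P x \<Longrightarrow> P y \<Longrightarrow> P (x * y)"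
    and "P h1_X" "P h1_Y" "P h1_delta1"
  shows "P (h :: h1)"
proof -
  have minus: "P (x - y)" if "P x" "P y" for x y
    using add[OF that(1) cscale[OF that(2), of "- 1"]] by (simp add: cscale_minus_left cscale_one)
  have "P (h1_delta m)" for m
    by (induction m) (auto simp: delta_Suc intro: minus mult assms)
  then have gen: "P (h1_of_gen g)" for g
    by (cases g) (auto intro: assms)
  have word: "P (abs_h1 (Poly_Mapping.single (Word gs) 1))" for gs
  proof (induction gs)
    case Nil
    have "abs_h1 (Poly_Mapping.single (Word []) 1) = 1"
      by (simp add: one_h1_def flip: single_one zero_word_def)
    then show ?case using assms(1) by simp
  next
    case (Cons g gs)
    have "abs_h1 (Poly_Mapping.single (Word (g # gs)) 1)
        = h1_of_gen g * abs_h1 (Poly_Mapping.single (Word gs) 1)"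
      by (simp add: h1_of_gen.abs_eq times_h1.abs_eq free_gen_def mult_single plus_word_def)
    then show ?case using Cons gen mult by simp
  qed
  have "P (abs_h1 p)" for p
  proof (induction p rule: poly_mapping_single_induct)
    case zero
    then show ?case using cscale[OF assms(1), of 0] by (simp add: cscale_zero_left flip: zero_h1_def)
  next
    case (single w c)
    have "abs_h1 (Poly_Mapping.single w c) = c *c abs_h1 (Poly_Mapping.single (Word (letters w)) 1)"
      by (simp add: cscale_h1.abs_eq mult_single)
    then show ?case using cscale[OF word[of "letters w"]] by simp
  next
    case (add p q)
    then show ?case using assms(3) by (simp flip: plus_h1.abs_eq)
  qed
  then show ?thesis by (rule h1.abs_induct[of P])
qed

lemma coproduct_alg_hom: "alg_hom coproduct"
  and coproduct_Y_eq: "coproduct h1_Y = h1_Y \<otimes> 1 + 1 \<otimes> h1_Y"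
  and coproduct_delta1_eq: "coproduct h1_delta1 = h1_delta1 \<otimes> 1 + 1 \<otimes> h1_delta1"
  and coproduct_X_eq: "coproduct h1_X = h1_X \<otimes> 1 + 1 \<otimes> h1_X + h1_delta1 \<otimes> h1_Y"
  using theI'[OF coproduct_exists_unique] unfolding coproduct_def by blast+

lemma counit_gen: "counit (h1_of_gen g) = 0"
  using theI'[OF counit_exists_unique] unfolding counit_def by blast

lemma modular_character_alg_hom: "alg_hom modular_character"
  and modular_character_gen: "modular_character h1_Y = 1" "modular_character h1_X = 0"
    "modular_character (h1_delta m) = 0"
  using theI'[OF modular_character_exists_unique] unfolding modular_character_def by blast+

text \<open>
  The second list is the outer loop, so that for a fixed entry of \<open>vs\<close> the sum over \<open>us\<close> is the
  Sweedler sum of the left factor.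
\<close>

definition pairs_mult :: "('a::times \<times> 'b::times) list \<Rightarrow> ('a \<times> 'b) list \<Rightarrow> ('a \<times> 'b) list" where
  "pairs_mult us vs = concat (map (\<lambda>(u', v'). map (\<lambda>(u, v). (u * u', v * v')) us) vs)"

lemma sum_list_pairs_mult:
  "(\<Sum>(u, v)\<leftarrow>pairs_mult us vs. F u v) = (\<Sum>(u', v')\<leftarrow>vs. \<Sum>(u, v)\<leftarrow>us. F (u * u') (v * v'))"
  by (induction vs) (auto simp: pairs_mult_def o_def split_def)

lemma pure_tensor_pairs_mult:
  "(\<Sum>(u, v)\<leftarrow>us. u \<otimes> v) * (\<Sum>(u, v)\<leftarrow>vs. u \<otimes> v) = (\<Sum>(u, v)\<leftarrow>pairs_mult us vs. u \<otimes> v)"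
proof -
  have "(\<Sum>(u, v)\<leftarrow>us. u \<otimes> v) * (u' \<otimes> v') = (\<Sum>(u, v)\<leftarrow>us. (u * u') \<otimes> (v * v'))" for u' v'
    by (induction us) (auto simp: distrib_right pure_tensor_mult)
  then show ?thesis
    unfolding sum_list_pairs_mult by (induction vs) (auto simp: distrib_left)
qed

section \<open>Invariance under the standard action\<close>

lemma sum_list_pairs_zero:
  assumes "\<And>u v. (u, v) \<in> set us \<Longrightarrow> F u v = 0"
  shows "(\<Sum>(u, v)\<leftarrow>us. F u v) = 0"
  using assms by (induction us) auto

lemma crossed_mult_constants:
  assumes "\<alpha> \<in> GL2Q_pos" "\<alpha> ** \<beta> = mat 1"
  shows "monomial 0 (on_uhp (\<lambda>_. c)) \<alpha> \<odot> monomial 0 (on_uhp (\<lambda>_. d)) \<beta>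
    = crossed_scale (c * d) crossed_one"
proof -
  have "(\<lambda>z. on_uhp (\<lambda>_. c) z * on_uhp (\<lambda>_. d) z) = (\<lambda>z. c * d * on_uhp (\<lambda>_. 1) z)"
    by (simp add: on_uhp_def fun_eq_iff)
  then show ?thesis
    using GL2Q_pos_inv(1)[OF assms(1)]
    by (simp add: crossed_mult_monomial slash_0_constant crossed_one_def crossed_scale_monomial assms(2))
qed

lemma crossed_one_in_crossed_product: "crossed_one \<in> crossed_product"
  unfolding crossed_one_def crossed_product_eq
  by (intro monomial_in_crossed_over constant_in_modular_forms_0 mat_1_in_GL2Q_pos)

lemma monomial_in_crossed_product:
  "f \<in> modular_forms k \<Longrightarrow> \<gamma> \<in> GL2Q_pos \<Longrightarrow> monomial k f \<gamma> \<in> crossed_product"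
  unfolding crossed_product_eq by (rule monomial_in_crossed_over)

lemma contour_integral_sum_list_lookup:
  assumes ab: "a \<in> upper_half_plane" "b \<in> upper_half_plane"
    and "\<And>p. p \<in> set ps \<Longrightarrow> p \<in> holomorphic_crossed"
  shows "(\<Sum>p\<leftarrow>ps. contour_integral (linepath a b) (Poly_Mapping.lookup p x))
    = contour_integral (linepath a b) (Poly_Mapping.lookup (sum_list ps) x)"
  using assms(3)
proof (induction ps)
  case (Cons p ps)
  have "sum_list ps \<in> holomorphic_crossed"
    using Cons.prems by (induction ps) (auto simp: zero_in_crossed_over intro!: holomorphic_crossed_add)
  then have "contour_integral (linepath a b) (Poly_Mapping.lookup (p + sum_list ps) x)
      = contour_integral (linepath a b) (Poly_Mapping.lookup p x)
        + contour_integral (linepath a b) (Poly_Mapping.lookup (sum_list ps) x)"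
    using Cons.prems ab unfolding lookup_add plus_fun_def
    by (intro uhp_contour_integral_add holomorphic_crossed_lookup) auto
  then show ?case using Cons by simp
qed (simp add: zero_fun_def)

context
  fixes z0 :: complex and act :: "h1 \<Rightarrow> crossed \<Rightarrow> crossed"
  assumes z0: "z0 \<in> upper_half_plane" and act: "standard_action act"
begin

lemma act_in: "a \<in> crossed_product \<Longrightarrow> act h a \<in> crossed_product"
  and act_add: "a \<in> crossed_product \<Longrightarrow> b \<in> crossed_product \<Longrightarrow> act h (a + b) = act h a + act h b"
  and act_scale: "a \<in> crossed_product \<Longrightarrow> act h (crossed_scale c a) = crossed_scale c (act h a)"
  and act_add_h: "a \<in> crossed_product \<Longrightarrow> act (g + h) a = act g a + act h a"
  and act_scale_h: "a \<in> crossed_product \<Longrightarrow> act (c *c h) a = crossed_scale c (act h a)"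
  and act_1: "a \<in> crossed_product \<Longrightarrow> act 1 a = a"
  and act_mult_h: "a \<in> crossed_product \<Longrightarrow> act (g * h) a = act g (act h a)"
  and act_mult: "a \<in> crossed_product \<Longrightarrow> b \<in> crossed_product \<Longrightarrow>
        coproduct h = (\<Sum>(u, v)\<leftarrow>us. u \<otimes> v) \<Longrightarrow>
        act h (a \<odot> b) = (\<Sum>(u, v)\<leftarrow>us. act u a \<odot> act v b)"
  and act_crossed_one: "act h crossed_one = crossed_scale (counit h) crossed_one"
  using conjunct1[OF act[unfolded standard_action_def], unfolded hopf_action_def] by simp_all

lemma act_zero: "act h 0 = 0"
  using act_add[of 0 0 h] by (simp add: zero_in_crossed_over crossed_product_eq)

lemma act_monomial:
  assumes f: "f \<in> modular_forms k" and \<gamma>: "\<gamma> \<in> GL2Q_pos"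
  shows "act h1_Y (monomial k f \<gamma>) = crossed_scale (of_int k / 2) (monomial k f \<gamma>)"
    and "act h1_X (monomial k f \<gamma>) = monomial (k + 2) (form_X k f) \<gamma>"
    and "act h1_delta1 (monomial k f \<gamma>) = monomial (k + 2) (\<lambda>z. mu (matrix_inv \<gamma>) z * f z) \<gamma>"
proof -
  have "matrix_inv (matrix_inv \<gamma>) = \<gamma>"
    by (rule matrix_inv_unique[OF GL2Q_pos_inv(3)[OF \<gamma>]])
  then show "act h1_Y (monomial k f \<gamma>) = crossed_scale (of_int k / 2) (monomial k f \<gamma>)"
    and "act h1_X (monomial k f \<gamma>) = monomial (k + 2) (form_X k f) \<gamma>"
    and "act h1_delta1 (monomial k f \<gamma>) = monomial (k + 2) (\<lambda>z. mu (matrix_inv \<gamma>) z * f z) \<gamma>"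
    using act f GL2Q_pos_inv(1)[OF \<gamma>] unfolding standard_action_def by metis+
qed

lemma crossed_product_holomorphic: "a \<in> crossed_product \<Longrightarrow> a \<in> holomorphic_crossed"
  using crossed_product_subset by blast

lemma tau0_act_tensor_eq:
  assumes ab: "a \<in> crossed_product" "b \<in> crossed_product"
    and "(\<Sum>(u, v)\<leftarrow>us. u \<otimes> v) = (\<Sum>(u, v)\<leftarrow>vs. u \<otimes> v)"
  shows "(\<Sum>(u, v)\<leftarrow>us. tau0 z0 (act u a) (act v b)) = (\<Sum>(u, v)\<leftarrow>vs. tau0 z0 (act u a) (act v b))"
  using assms(3)
  by (rule bilinear_sum_tensor_eq[of "\<lambda>u v. tau0 z0 (act u a) (act v b)", rotated -1])
     (simp_all add: act_add_h act_scale_h ab tau0_add_left[OF z0] tau0_add_right[OF z0]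
       tau0_scale[OF z0] act_in crossed_product_holomorphic)

definition raises_weight :: "h1 \<Rightarrow> int \<Rightarrow> bool" where
  "raises_weight h n \<longleftrightarrow> (\<forall>k. \<forall>f\<in>modular_forms k. \<forall>\<gamma>\<in>GL2Q_pos.
     \<exists>f'. act h (monomial k f \<gamma>) = monomial (k + n) f' \<gamma>)"

lemma raises_weight_1: "raises_weight 1 0"
  unfolding raises_weight_def by (auto simp: act_1 monomial_in_crossed_product)

lemma raises_weight_gen:
  "raises_weight h1_X 2" "raises_weight h1_Y 0" "raises_weight h1_delta1 2"
  unfolding raises_weight_def by (auto simp: act_monomial crossed_scale_monomial)

text \<open>
  On monomials \<open>p U\<^sub>\<alpha>\<close> and \<open>q U\<^sub>\<beta>\<close> with \<open>\<alpha>\<beta> = 1\<close> and total weight 2, the functional is the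
  integral of the coefficient of the product at \<open>U\<^sub>1\<close>, along a segment that depends on \<open>\<alpha>\<close> only.
  All terms of the sum are values at such a pair if \<open>\<alpha>\<beta> = 1\<close> and the weights of \<open>f\<close> and \<open>g\<close>
  add up to 0, and they vanish otherwise. With opposite weights, \<open>f\<close> and \<open>g\<close> are constants or one of them is 0. Then
  the product of the two given monomials is a multiple of the unit, which \<open>h\<close> annihilates, and the
  sum is the integral of a coefficient of \<open>h\<close> applied to this product.
\<close>

lemma tau0_act_raising:
  assumes f: "f \<in> modular_forms k" and \<alpha>: "\<alpha> \<in> GL2Q_pos"
    and g: "g \<in> modular_forms l" and \<beta>: "\<beta> \<in> GL2Q_pos"
    and h: "coproduct h = (\<Sum>(u, v)\<leftarrow>us. u \<otimes> v)" "counit h = 0"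
    and raising: "\<And>u v. (u, v) \<in> set us \<Longrightarrow> \<exists>m n. raises_weight u m \<and> raises_weight v n \<and> m + n = 2"
  shows "(\<Sum>(u, v)\<leftarrow>us. tau0 z0 (act u (monomial k f \<alpha>)) (act v (monomial l g \<beta>))) = 0"
proof -
  let ?a = "monomial k f \<alpha>" and ?b = "monomial l g \<beta>"
  have monomials: "\<exists>k' f' l' g'. k' + l' = k + l + 2 \<and> act u ?a = monomial k' f' \<alpha>
      \<and> act v ?b = monomial l' g' \<beta>" if uv: "(u, v) \<in> set us" for u v
  proof -
    obtain m n f' g' where "m + n = 2" "act u ?a = monomial (k + m) f' \<alpha>" "act v ?b = monomial (l + n) g' \<beta>"
      using raising[OF uv] f \<alpha> g \<beta> unfolding raises_weight_def by blast
    moreover from this(1) have "(k + m) + (l + n) = k + l + 2" by simp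
    ultimately show ?thesis by blast
  qed
  show ?thesis
  proof (cases "k + l = 0 \<and> \<alpha> ** \<beta> = mat 1")
    case False
    have "tau0 z0 (act u (monomial k f \<alpha>)) (act v (monomial l g \<beta>)) = 0" if "(u, v) \<in> set us" for u v
      using monomials[OF that] False by (auto simp: tau0_monomial_eq_tau0[OF z0] tau0_monomial_def)
    then show ?thesis by (rule sum_list_pairs_zero)
  next
    case True
    then have kl: "k + l = 0" and \<alpha>\<beta>: "\<alpha> ** \<beta> = mat 1" by auto
    have ab: "?a \<in> crossed_product" "?b \<in> crossed_product"
      by (intro monomial_in_crossed_product f g \<alpha> \<beta>)+
    show ?thesis
    proof (cases "k = 0")
      case False
      then have "f = 0 \<or> g = 0"
        using modular_forms_negative[OF f] modular_forms_negative[OF g] kl by linarith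
      then have "?a = 0 \<or> ?b = 0" by (auto simp: monomial_def)
      then have "tau0 z0 (act u ?a) (act v ?b) = 0" for u v
        by (auto simp: act_zero tau0_zero[OF z0])
      then show ?thesis by (intro sum_list_pairs_zero)
    next
      case k: True
      then have l: "l = 0" using kl by simp
      obtain c d where "f = on_uhp (\<lambda>_. c)" "g = on_uhp (\<lambda>_. d)"
        using modular_forms_0_constant f g k l by metis
      then have "?a \<odot> ?b = crossed_scale (c * d) crossed_one"
        using crossed_mult_constants[OF \<alpha> \<alpha>\<beta>] k l by simp
      then have "act h (?a \<odot> ?b) = crossed_scale (c * d) (crossed_scale 0 crossed_one)"
        using act_scale[OF crossed_one_in_crossed_product] act_crossed_one h(2) by simp
      also have "\<dots> = 0"
        by (rule poly_mapping_eqI) (simp add: lookup_crossed_scale fun_eq_iff)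
      finally have zero: "(\<Sum>(u, v)\<leftarrow>us. act u ?a \<odot> act v ?b) = 0"
        using act_mult[OF ab h(1)] by simp
      have "tau0 z0 (act u ?a) (act v ?b) = contour_integral (linepath z0 (moebius \<alpha> z0))
          (Poly_Mapping.lookup (act u ?a \<odot> act v ?b) (2, mat 1))" if uv: "(u, v) \<in> set us" for u v
      proof -
        obtain k' f' l' g' where *: "k' + l' = 2" "act u ?a = monomial k' f' \<alpha>" "act v ?b = monomial l' g' \<beta>"
          using monomials[OF uv] kl by auto
        have "matrix_inv \<alpha> = \<beta>" by (rule matrix_inv_unique[OF \<alpha>\<beta>])
        then show ?thesis
          by (simp add: * tau0_monomial_eq_tau0[OF z0] tau0_monomial_def crossed_mult_monomial \<alpha>\<beta>)
             (simp add: monomial_def)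
      qed
      then have "(\<Sum>(u, v)\<leftarrow>us. tau0 z0 (act u ?a) (act v ?b))
          = (\<Sum>p\<leftarrow>map (\<lambda>(u, v). act u ?a \<odot> act v ?b) us. contour_integral (linepath z0 (moebius \<alpha> z0))
              (Poly_Mapping.lookup p (2, mat 1)))"
        by (auto simp: o_def split_def intro!: arg_cong[of _ _ sum_list])
      also have "\<dots> = contour_integral (linepath z0 (moebius \<alpha> z0))
          (Poly_Mapping.lookup (\<Sum>(u, v)\<leftarrow>us. act u ?a \<odot> act v ?b) (2, mat 1))"
        by (rule contour_integral_sum_list_lookup[OF z0 moebius_in_uhp[OF \<alpha> z0]])
           (auto intro!: holomorphic_crossed_mult intro: crossed_product_holomorphic act_in ab)
      finally show ?thesis by (simp add: zero zero_fun_def)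
    qed
  qed
qed

lemma tau0_act_bilinear_ext:
  assumes "\<And>k f \<alpha> l g \<beta>. f \<in> modular_forms k \<Longrightarrow> \<alpha> \<in> GL2Q_pos \<Longrightarrow> g \<in> modular_forms l \<Longrightarrow> \<beta> \<in> GL2Q_pos \<Longrightarrow>
      (\<Sum>(u, v)\<leftarrow>us. tau0 z0 (act u (monomial k f \<alpha>)) (act v (monomial l g \<beta>)))
        = c * tau0 z0 (monomial k f \<alpha>) (monomial l g \<beta>)"
    and a: "a \<in> crossed_product" and b: "b \<in> crossed_product"
  shows "(\<Sum>(u, v)\<leftarrow>us. tau0 z0 (act u a) (act v b)) = c * tau0 z0 a b"
proof -
  define T where "T a b = (\<Sum>(u, v)\<leftarrow>us. tau0 z0 (act u a) (act v b))" for a b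
  note hol = crossed_product_holomorphic
  have T_add: "T (a + a') b = T a b + T a' b" "T b (a + a') = T b a + T b a'"
    if "a \<in> crossed_product" "a' \<in> crossed_product" "b \<in> crossed_product" for a a' b
    using that
    by (simp_all add: T_def act_add tau0_add_left[OF z0] tau0_add_right[OF z0] act_in hol split_def
        sum_list_addf)
  have T_zero: "T 0 b = 0" "T b 0 = 0" for b
    unfolding T_def by (intro sum_list_pairs_zero; simp add: act_zero tau0_zero[OF z0])+
  have "T a b = c * tau0 z0 a b"
    using a unfolding crossed_product_eq
  proof (induction a rule: crossed_over_induct)
    case (monomial k f \<alpha>)
    then have m: "monomial k f \<alpha> \<in> crossed_product"
      by (intro monomial_in_crossed_product)
    show ?case
      using b unfolding crossed_product_eq
    proof (induction b rule: crossed_over_induct)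
      case (monomial l g \<beta>)
      then show ?case using assms(1) \<open>f \<in> modular_forms k\<close> \<open>\<alpha> \<in> GL2Q_pos\<close> by (simp add: T_def)
    next
      case (add p q)
      then show ?case
        using m by (simp add: T_add tau0_add_right[OF z0] hol distrib_left flip: crossed_product_eq)
    qed (simp add: T_zero tau0_zero[OF z0])
  next
    case (add p q)
    then show ?case
      using b by (simp add: T_add tau0_add_left[OF z0] hol distrib_left flip: crossed_product_eq)
  qed (simp add: T_zero tau0_zero[OF z0])
  then show ?thesis by (simp add: T_def)
qed

text \<open>
  By \<open>tau0_act_tensor_eq\<close> one list of pairs stands for all of them. Asking for one list makes
  closure under products a matter of exhibiting a list.
\<close>

definition invariant :: "h1 \<Rightarrow> bool" where
  "invariant h \<longleftrightarrow> (\<exists>us. coproduct h = (\<Sum>(u, v)\<leftarrow>us. u \<otimes> v) \<and>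
     (\<forall>a\<in>crossed_product. \<forall>b\<in>crossed_product.
        (\<Sum>(u, v)\<leftarrow>us. tau0 z0 (act u a) (act v b)) = modular_character h * tau0 z0 a b))"

lemma invariant_Y: "invariant h1_Y"
  unfolding invariant_def
proof (intro exI conjI ballI)
  show "coproduct h1_Y = (\<Sum>(u, v)\<leftarrow>[(h1_Y, 1), (1, h1_Y)]. u \<otimes> v)"
    by (simp add: coproduct_Y_eq)
  fix a b assume ab: "a \<in> crossed_product" "b \<in> crossed_product"
  show "(\<Sum>(u, v)\<leftarrow>[(h1_Y, 1), (1, h1_Y)]. tau0 z0 (act u a) (act v b)) = modular_character h1_Y * tau0 z0 a b"
  proof (rule tau0_act_bilinear_ext[OF _ ab])
    fix k f \<alpha> l g \<beta>
    assume fg: "f \<in> modular_forms k" "\<alpha> \<in> GL2Q_pos" "g \<in> modular_forms l" "\<beta> \<in> GL2Q_pos"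
    let ?a = "monomial k f \<alpha>" and ?b = "monomial l g \<beta>"
    have m: "?a \<in> crossed_product" "?b \<in> crossed_product"
      by (intro monomial_in_crossed_product fg)+
    have "of_int k / 2 * tau0 z0 ?a ?b + of_int l / 2 * tau0 z0 ?a ?b = of_int (k + l) / 2 * tau0 z0 ?a ?b"
      by (simp add: distrib_right add_divide_distrib)
    also have "\<dots> = tau0 z0 ?a ?b"
      by (cases "k + l = 2") (simp_all add: tau0_monomial_eq_tau0[OF z0] tau0_monomial_def del: of_int_add)
    finally show "(\<Sum>(u, v)\<leftarrow>[(h1_Y, 1), (1, h1_Y)]. tau0 z0 (act u ?a) (act v ?b))
        = modular_character h1_Y * tau0 z0 ?a ?b"
      using m by (simp add: act_1 act_monomial fg tau0_scale[OF z0] crossed_product_holomorphic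
          modular_character_gen)
  qed
qed

lemma invariant_raising:
  assumes h: "coproduct h = (\<Sum>(u, v)\<leftarrow>us. u \<otimes> v)" "counit h = 0" "modular_character h = 0"
    and raising: "\<And>u v. (u, v) \<in> set us \<Longrightarrow> \<exists>m n. raises_weight u m \<and> raises_weight v n \<and> m + n = 2"
  shows "invariant h"
  unfolding invariant_def
proof (intro exI conjI ballI)
  fix a b assume ab: "a \<in> crossed_product" "b \<in> crossed_product"
  show "(\<Sum>(u, v)\<leftarrow>us. tau0 z0 (act u a) (act v b)) = modular_character h * tau0 z0 a b"
    unfolding h(3)
  proof (rule tau0_act_bilinear_ext[OF _ ab])
    fix k f \<alpha> l g \<beta>
    assume fg: "f \<in> modular_forms k" "\<alpha> \<in> GL2Q_pos" "g \<in> modular_forms l" "\<beta> \<in> GL2Q_pos"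
    show "(\<Sum>(u, v)\<leftarrow>us. tau0 z0 (act u (monomial k f \<alpha>)) (act v (monomial l g \<beta>)))
        = 0 * tau0 z0 (monomial k f \<alpha>) (monomial l g \<beta>)"
      using tau0_act_raising[OF fg h(1,2) raising] by simp
  qed
qed (rule h(1))

lemma invariant_delta1: "invariant h1_delta1"
proof (rule invariant_raising)
  show "coproduct h1_delta1 = (\<Sum>(u, v)\<leftarrow>[(h1_delta1, 1), (1, h1_delta1)]. u \<otimes> v)"
    by (simp add: coproduct_delta1_eq)
  show "\<exists>m n. raises_weight u m \<and> raises_weight v n \<and> m + n = 2"
    if "(u, v) \<in> set [(h1_delta1, 1), (1, h1_delta1)]" for u v
    using that raises_weight_1 raises_weight_gen by fastforce
qed (simp_all add: counit_gen modular_character_gen)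

lemma invariant_X: "invariant h1_X"
proof (rule invariant_raising)
  show "coproduct h1_X = (\<Sum>(u, v)\<leftarrow>[(h1_X, 1), (1, h1_X), (h1_delta1, h1_Y)]. u \<otimes> v)"
    by (simp add: coproduct_X_eq add.assoc)
  show "\<exists>m n. raises_weight u m \<and> raises_weight v n \<and> m + n = 2"
    if "(u, v) \<in> set [(h1_X, 1), (1, h1_X), (h1_delta1, h1_Y)]" for u v
    using that raises_weight_1 raises_weight_gen by fastforce
qed (simp_all add: counit_gen modular_character_gen)

lemma invariant_all: "invariant h"
proof (induction h rule: h1_generated)
  case one
  have "coproduct 1 = (\<Sum>(u, v)\<leftarrow>[(1, 1)]. u \<otimes> v)" "modular_character 1 = 1"
    using coproduct_alg_hom modular_character_alg_hom by (simp_all add: alg_hom_def pure_tensor_one)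
  then show ?case
    unfolding invariant_def by (intro exI[of _ "[(1, 1)]"]) (simp add: act_1)
next
  case (cscale c h)
  then obtain us where us: "coproduct h = (\<Sum>(u, v)\<leftarrow>us. u \<otimes> v)"
    "\<And>a b. a \<in> crossed_product \<Longrightarrow> b \<in> crossed_product \<Longrightarrow>
        (\<Sum>(u, v)\<leftarrow>us. tau0 z0 (act u a) (act v b)) = modular_character h * tau0 z0 a b"
    unfolding invariant_def by blast
  let ?us = "map (\<lambda>(u, v). (c *c u, v)) us"
  have "c *c (\<Sum>(u, v)\<leftarrow>us. u \<otimes> v) = (\<Sum>(u, v)\<leftarrow>?us. u \<otimes> v)"
    by (induction us) (auto simp: cscale_add_right cscale_zero_right pure_tensor_cscale_left)
  then have "coproduct (c *c h) = (\<Sum>(u, v)\<leftarrow>?us. u \<otimes> v)"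
    using coproduct_alg_hom us(1) by (simp add: alg_hom_def)
  moreover have "(\<Sum>(u, v)\<leftarrow>?us. tau0 z0 (act u a) (act v b)) = modular_character (c *c h) * tau0 z0 a b"
    if ab: "a \<in> crossed_product" "b \<in> crossed_product" for a b
  proof -
    have "(\<Sum>(u, v)\<leftarrow>?us. tau0 z0 (act u a) (act v b)) = c * (\<Sum>(u, v)\<leftarrow>us. tau0 z0 (act u a) (act v b))"
      by (induction us)
         (auto simp: act_scale_h ab tau0_scale[OF z0] act_in crossed_product_holomorphic distrib_left)
    also have "\<dots> = modular_character (c *c h) * tau0 z0 a b"
      using modular_character_alg_hom us(2)[OF ab] by (simp add: alg_hom_def cscale_complex_def)
    finally show ?thesis .
  qed
  ultimately show ?case unfolding invariant_def by blast
next
  case (add g h)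
  then obtain us vs where us: "coproduct g = (\<Sum>(u, v)\<leftarrow>us. u \<otimes> v)" "coproduct h = (\<Sum>(u, v)\<leftarrow>vs. u \<otimes> v)"
    "\<And>a b. a \<in> crossed_product \<Longrightarrow> b \<in> crossed_product \<Longrightarrow>
        (\<Sum>(u, v)\<leftarrow>us. tau0 z0 (act u a) (act v b)) = modular_character g * tau0 z0 a b"
    "\<And>a b. a \<in> crossed_product \<Longrightarrow> b \<in> crossed_product \<Longrightarrow>
        (\<Sum>(u, v)\<leftarrow>vs. tau0 z0 (act u a) (act v b)) = modular_character h * tau0 z0 a b"
    unfolding invariant_def by blast
  have "coproduct (g + h) = (\<Sum>(u, v)\<leftarrow>us @ vs. u \<otimes> v)"
    using coproduct_alg_hom us(1,2) by (simp add: alg_hom_def)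
  moreover have "modular_character (g + h) = modular_character g + modular_character h"
    using modular_character_alg_hom by (simp add: alg_hom_def)
  ultimately show ?case
    unfolding invariant_def by (intro exI[of _ "us @ vs"]) (simp add: us(3,4) distrib_right)
next
  case (mult g h)
  then obtain us vs where us: "coproduct g = (\<Sum>(u, v)\<leftarrow>us. u \<otimes> v)" "coproduct h = (\<Sum>(u, v)\<leftarrow>vs. u \<otimes> v)"
    "\<And>a b. a \<in> crossed_product \<Longrightarrow> b \<in> crossed_product \<Longrightarrow>
        (\<Sum>(u, v)\<leftarrow>us. tau0 z0 (act u a) (act v b)) = modular_character g * tau0 z0 a b"
    "\<And>a b. a \<in> crossed_product \<Longrightarrow> b \<in> crossed_product \<Longrightarrow>
        (\<Sum>(u, v)\<leftarrow>vs. tau0 z0 (act u a) (act v b)) = modular_character h * tau0 z0 a b"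
    unfolding invariant_def by blast
  have "coproduct (g * h) = (\<Sum>(u, v)\<leftarrow>pairs_mult us vs. u \<otimes> v)"
    using coproduct_alg_hom us(1,2) by (simp add: alg_hom_def pure_tensor_pairs_mult)
  moreover have "(\<Sum>(u, v)\<leftarrow>pairs_mult us vs. tau0 z0 (act u a) (act v b)) = modular_character (g * h) * tau0 z0 a b"
    if ab: "a \<in> crossed_product" "b \<in> crossed_product" for a b
  proof -
    have "(\<Sum>(u, v)\<leftarrow>pairs_mult us vs. tau0 z0 (act u a) (act v b))
        = (\<Sum>(u', v')\<leftarrow>vs. \<Sum>(u, v)\<leftarrow>us. tau0 z0 (act u (act u' a)) (act v (act v' b)))"
      by (simp add: sum_list_pairs_mult act_mult_h ab)
    also have "\<dots> = modular_character g * (\<Sum>(u', v')\<leftarrow>vs. tau0 z0 (act u' a) (act v' b))"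
      by (simp add: us(3) act_in ab) (simp add: split_def sum_list_const_mult)
    also have "\<dots> = modular_character (g * h) * tau0 z0 a b"
      using modular_character_alg_hom us(4)[OF ab] by (simp add: alg_hom_def)
    finally show ?thesis .
  qed
  ultimately show ?case unfolding invariant_def by blast
qed (rule invariant_X invariant_Y invariant_delta1)+

lemma tau0_invariant:
  assumes "a \<in> crossed_product" "b \<in> crossed_product" "coproduct h = (\<Sum>(u, v)\<leftarrow>us. u \<otimes> v)"
  shows "(\<Sum>(u, v)\<leftarrow>us. tau0 z0 (act u a) (act v b)) = modular_character h * tau0 z0 a b"
  using invariant_all[of h] tau0_act_tensor_eq[OF assms(1,2)] assms unfolding invariant_def by metis

end

theorem proposition2:
  fixes z0 :: complex
  assumes "z0 \<in> upper_half_plane"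
  shows "cyclic_cocycle (tau0 z0) \<and>
    (\<forall>act. standard_action act \<longrightarrow>
      (\<forall>h us. \<forall>a0\<in>crossed_product. \<forall>a1\<in>crossed_product.
         coproduct h = (\<Sum>(u, v)\<leftarrow>us. u \<otimes> v) \<longrightarrow>
         (\<Sum>(u, v)\<leftarrow>us. tau0 z0 (act u a0) (act v a1)) = modular_character h * tau0 z0 a0 a1))"
  using cyclic_cocycle_tau0[OF assms] tau0_invariant[OF assms] by blast

end
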